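(* Let $V\subset\mathbb R^m$ be a domain and let $P=V\times T^m$ be equipped with coordinates $(I_k,\phi^k)$, $k=1,\dots,m$ ($\phi^k$ cyclic coordinates of period $2\pi$ on the torus $T^m$), and with the symplectic form $\Omega_P=dI_k\wedge d\phi^k$. Let $\mathcal A\subset C^\infty(P)$ be the Lie algebra, under the Poisson bracket, of functions $f=a^k(\phi)I_k+b(\phi)$ with $a^k,b\in C^\infty(T^m)$ real. For each $\lambda=(\lambda_1,\dots,\lambda_m)\in\mathbb R^m$ and $f=a^kI_k+b\in\mathcal A$ define the operator $$\widehat f=-ia^k\partial_k-\tfrac{i}{2}\,\partial_ka^k-a^k\lambda_k+b$$ on the space $\mathbb C^\infty(T^m)$ of smooth complex functions on $T^m$, where $\partial_k=\partial/\partial\phi^k$. Equip $\mathbb C^\infty(T^m)$ with the Hermitian form $\langle\rho|\rho'\rangle=(2\pi)^{-m}\int_{T^m}\rho\,\overline{\rho'}$. Then: (1) for every $\lambda$ the operators $\widehat f$, $f\in\mathcal A$, are Hermitian (symmetric) and satisfy the Dirac condition $[\widehat f,\widehat{f'}]=-i\,\widehat{\{f,f'\}}$ for all $f,f'\in\mathcal A$; (2) the action operators are $\widehat I_k=-i\partial_k-\lambda_k$, and $\widehat I_k\psi_{(n_r)}=(n_k-\lambda_k)\psi_{(n_r)}$ for the orthonormal basis $\psi_{(n_r)}=\exp[i\,n_r\phi^r]$, $(n_r)\in\mathbb Z^m$, of $\mathbb C^\infty(T^m)$; (3) the representations of $\mathcal A$ determined by $\lambda$ and $\lambda'$ are inequivalent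 unless $\lambda_k-\lambda'_k\in\mathbb Z$ for all $k$.
   Context: Summation over repeated indices is understood. The Poisson bracket on $P$ is $\{f,f'\}=\frac{\partial f}{\partial I_k}\frac{\partial f'}{\partial\phi^k}-\frac{\partial f}{\partial\phi^k}\frac{\partial f'}{\partial I_k}$. "Orthonormal basis" of the pre-Hilbert space $\mathbb C^\infty(T^m)$ is meant in the sense of multidimensional Fourier series. Two representations of $\mathcal A$ on $\mathbb C^\infty(T^m)$ are equivalent if there is a unitary operator of the pre-Hilbert space $\mathbb C^\infty(T^m)$ onto itself intertwining the operators assigned to each $f\in\mathcal A$. *)

theory Defs
  imports "HOL-Analysis.Analysis"
begin

section \<open>Smooth functions\<close>

text \<open>Only used for open \<open>S\<close>. For a differentiable function, the Frechet derivative applied to a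
  vector \<open>v\<close> is the directional derivative, so this says that all iterated directional
  derivatives of order at most \<open>n\<close> exist and are continuous on \<open>S\<close>.\<close>

primrec Ck_on :: "nat \<Rightarrow> 'a::real_normed_vector set \<Rightarrow> ('a \<Rightarrow> 'b::real_normed_vector) \<Rightarrow> bool" where
  "Ck_on 0 S f \<longleftrightarrow> continuous_on S f"
| "Ck_on (Suc n) S f \<longleftrightarrow>
     (\<forall>x\<in>S. f differentiable at x) \<and> (\<forall>v. Ck_on n S (\<lambda>x. frechet_derivative f (at x) v))"

definition smooth_on :: "'a::real_normed_vector set \<Rightarrow> ('a \<Rightarrow> 'b::real_normed_vector) \<Rightarrow> bool" where
  "smooth_on S f \<longleftrightarrow> (\<forall>n. Ck_on n S f)"


section \<open>The torus\<close>

text \<open>Functions on the torus \<open>T^m\<close> are functions of the cyclic coordinates, that is, functions on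
  \<open>R^m\<close> that are \<open>2 pi\<close>-periodic in every coordinate. The number \<open>m \<ge> 1\<close> is \<open>CARD('m)\<close>.\<close>

definition torus_smooth :: "(real^'m \<Rightarrow> 'b::real_normed_vector) set" where
  "torus_smooth = {g. smooth_on UNIV g \<and> (\<forall>k \<phi>. g (\<phi> + axis k (2 * pi)) = g \<phi>)}"

definition partial :: "'m \<Rightarrow> (real^'m \<Rightarrow> 'b::real_normed_vector) \<Rightarrow> real^'m \<Rightarrow> 'b" where
  "partial k g \<phi> = frechet_derivative g (at \<phi>) (axis k 1)"

definition torus_inner :: "(real^'m \<Rightarrow> complex) \<Rightarrow> (real^'m \<Rightarrow> complex) \<Rightarrow> complex" where
  "torus_inner \<rho> \<rho>' =
     (1 / of_real (2 * pi) ^ CARD('m)) * integral (cbox 0 (\<chi> k. 2 * pi)) (\<lambda>\<phi>. \<rho> \<phi> * cnj (\<rho>' \<phi>))"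

definition torus_norm :: "(real^'m \<Rightarrow> complex) \<Rightarrow> real" where
  "torus_norm \<rho> = sqrt (Re (torus_inner \<rho> \<rho>))"

text \<open>Basis in the sense of Fourier series: every function is the limit, in the norm of the
  pre-Hilbert space, of the net of finite partial sums of its Fourier expansion.\<close>

definition orthonormal_basis :: "('i \<Rightarrow> real^'m \<Rightarrow> complex) \<Rightarrow> bool" where
  "orthonormal_basis \<psi> \<longleftrightarrow>
     (\<forall>n. \<psi> n \<in> torus_smooth) \<and>
     (\<forall>n n'. torus_inner (\<psi> n) (\<psi> n') = (if n = n' then 1 else 0)) \<and>
     (\<forall>\<rho>\<in>torus_smooth.
        ((\<lambda>F. torus_norm (\<lambda>\<phi>. \<rho> \<phi> - (\<Sum>n\<in>F. torus_inner \<rho> (\<psi> n) * \<psi> n \<phi>))) \<longlongrightarrow> 0)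
          (finite_subsets_at_top UNIV))"

definition fourier_mode :: "int^'m \<Rightarrow> real^'m \<Rightarrow> complex" where
  "fourier_mode n \<phi> = exp (\<i> * of_real (\<Sum>r\<in>UNIV. of_int (n $ r) * \<phi> $ r))"


section \<open>Operators on the space of smooth complex functions on the torus\<close>

definition torus_operator :: "((real^'m \<Rightarrow> complex) \<Rightarrow> (real^'m \<Rightarrow> complex)) \<Rightarrow> bool" where
  "torus_operator T \<longleftrightarrow>
     (\<forall>\<rho>\<in>torus_smooth. T \<rho> \<in> torus_smooth) \<and>
     (\<forall>\<rho>\<in>torus_smooth. \<forall>\<rho>'\<in>torus_smooth. T (\<lambda>\<phi>. \<rho> \<phi> + \<rho>' \<phi>) = (\<lambda>\<phi>. T \<rho> \<phi> + T \<rho>' \<phi>)) \<and>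
     (\<forall>c. \<forall>\<rho>\<in>torus_smooth. T (\<lambda>\<phi>. c * \<rho> \<phi>) = (\<lambda>\<phi>. c * T \<rho> \<phi>))"

definition hermitian_operator :: "((real^'m \<Rightarrow> complex) \<Rightarrow> (real^'m \<Rightarrow> complex)) \<Rightarrow> bool" where
  "hermitian_operator T \<longleftrightarrow> torus_operator T \<and>
     (\<forall>\<rho>\<in>torus_smooth. \<forall>\<rho>'\<in>torus_smooth. torus_inner (T \<rho>) \<rho>' = torus_inner \<rho> (T \<rho>'))"

definition unitary_operator :: "((real^'m \<Rightarrow> complex) \<Rightarrow> (real^'m \<Rightarrow> complex)) \<Rightarrow> bool" where
  "unitary_operator U \<longleftrightarrow> torus_operator U \<and> bij_betw U torus_smooth torus_smooth \<and>
     (\<forall>\<rho>\<in>torus_smooth. \<forall>\<rho>'\<in>torus_smooth. torus_inner (U \<rho>) (U \<rho>') = torus_inner \<rho> \<rho>')"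

definition commutator ::
  "((real^'m \<Rightarrow> complex) \<Rightarrow> (real^'m \<Rightarrow> complex)) \<Rightarrow> ((real^'m \<Rightarrow> complex) \<Rightarrow> (real^'m \<Rightarrow> complex)) \<Rightarrow>
     (real^'m \<Rightarrow> complex) \<Rightarrow> (real^'m \<Rightarrow> complex)" where
  "commutator S T \<rho> = (\<lambda>\<phi>. S (T \<rho>) \<phi> - T (S \<rho>) \<phi>)"


section \<open>The phase space \<open>P = V \<times> T^m\<close>\<close>

definition domain :: "'a::topological_space set \<Rightarrow> bool" where
  "domain V \<longleftrightarrow> open V \<and> connected V \<and> V \<noteq> {}"

text \<open>A point of \<open>P\<close> is given by its coordinates \<open>(I, \<phi>)\<close>. A function on \<open>P\<close> is represented by a
  total function whose values at points with \<open>I \<notin> V\<close> are irrelevant.\<close>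

definition phase_smooth :: "(real^'m) set \<Rightarrow> ((real^'m) \<times> (real^'m) \<Rightarrow> real) set" where
  "phase_smooth V = {f. smooth_on (V \<times> UNIV) f \<and>
     (\<forall>I\<in>V. \<forall>\<phi> k. f (I, \<phi> + axis k (2 * pi)) = f (I, \<phi>))}"

definition partial_I ::
  "'m \<Rightarrow> ((real^'m) \<times> (real^'m) \<Rightarrow> real) \<Rightarrow> (real^'m) \<times> (real^'m) \<Rightarrow> real" where
  "partial_I k f z = frechet_derivative f (at z) (axis k 1, 0)"

definition partial_phi ::
  "'m \<Rightarrow> ((real^'m) \<times> (real^'m) \<Rightarrow> real) \<Rightarrow> (real^'m) \<times> (real^'m) \<Rightarrow> real" where
  "partial_phi k f z = frechet_derivative f (at z) (0, axis k 1)"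

definition poisson_bracket ::
  "((real^'m) \<times> (real^'m) \<Rightarrow> real) \<Rightarrow> ((real^'m) \<times> (real^'m) \<Rightarrow> real) \<Rightarrow> (real^'m) \<times> (real^'m) \<Rightarrow> real" where
  "poisson_bracket f f' z =
     (\<Sum>k\<in>UNIV. partial_I k f z * partial_phi k f' z - partial_phi k f z * partial_I k f' z)"

definition affine_form ::
  "(real^'m) set \<Rightarrow> ((real^'m) \<times> (real^'m) \<Rightarrow> real) \<Rightarrow>
     ('m \<Rightarrow> real^'m \<Rightarrow> real) \<Rightarrow> (real^'m \<Rightarrow> real) \<Rightarrow> bool" where
  "affine_form V f a b \<longleftrightarrow> (\<forall>k. a k \<in> torus_smooth) \<and> b \<in> torus_smooth \<and>
     (\<forall>I\<in>V. \<forall>\<phi>. f (I, \<phi>) = (\<Sum>k\<in>UNIV. a k \<phi> * I $ k) + b \<phi>)"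

definition affine_algebra :: "(real^'m) set \<Rightarrow> ((real^'m) \<times> (real^'m) \<Rightarrow> real) set" where
  "affine_algebra V = {f \<in> phase_smooth V. \<exists>a b. affine_form V f a b}"

definition action_fun :: "'m \<Rightarrow> (real^'m) \<times> (real^'m) \<Rightarrow> real" where
  "action_fun k = (\<lambda>(I, \<phi>). I $ k)"


section \<open>The operators assigned to affine functions\<close>

definition coeff_operator ::
  "real^'m \<Rightarrow> ('m \<Rightarrow> real^'m \<Rightarrow> real) \<Rightarrow> (real^'m \<Rightarrow> real) \<Rightarrow>
     (real^'m \<Rightarrow> complex) \<Rightarrow> (real^'m \<Rightarrow> complex)" where
  "coeff_operator lam a b \<rho> = (\<lambda>\<phi>.
     - \<i> * (\<Sum>k\<in>UNIV. of_real (a k \<phi>) * partial k \<rho> \<phi>)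
     - (\<i> / 2) * of_real (\<Sum>k\<in>UNIV. partial k (a k) \<phi>) * \<rho> \<phi>
     - of_real (\<Sum>k\<in>UNIV. a k \<phi> * lam $ k) * \<rho> \<phi>
     + of_real (b \<phi>) * \<rho> \<phi>)"

definition quantization ::
  "(real^'m) set \<Rightarrow> real^'m \<Rightarrow> ((real^'m) \<times> (real^'m) \<Rightarrow> real) \<Rightarrow>
     (real^'m \<Rightarrow> complex) \<Rightarrow> (real^'m \<Rightarrow> complex)" where
  "quantization V lam f =
     (let (a, b) = (THE (a, b). affine_form V f a b) in coeff_operator lam a b)"

text \<open>The coefficients of \<open>f\<close> are unique, since \<open>V\<close> is open and nonempty.\<close>

lemma affine_form_unique:
  assumes V: "domain V" and 1: "affine_form V f a b" and 2: "affine_form V f a' b'"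
  shows "a = a' \<and> b = b'"
proof -
  from V obtain I0 e where I0: "I0 \<in> V" and e: "e > 0" "ball I0 e \<subseteq> V"
    unfolding domain_def by (meson ex_in_conv open_contains_ball)
  have val: "(\<Sum>k\<in>UNIV. a k \<phi> * I $ k) + b \<phi> = (\<Sum>k\<in>UNIV. a' k \<phi> * I $ k) + b' \<phi>"
    if "I \<in> V" for I \<phi>
    using 1 2 that unfolding affine_form_def by metis
  have aa: "a j \<phi> = a' j \<phi>" for j \<phi>
  proof -
    let ?J = "I0 + axis j (e / 2)"
    have J: "?J \<in> V"
      using e by (intro subsetD[OF e(2)]) (simp add: dist_norm norm_eq_sqrt_inner inner_axis_axis real_sqrt_divide)
    have shift: "(\<Sum>k\<in>UNIV. c k \<phi> * ?J $ k) = (\<Sum>k\<in>UNIV. c k \<phi> * I0 $ k) + c j \<phi> * (e / 2)"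
      for c :: "'a \<Rightarrow> real^'a \<Rightarrow> real"
    proof -
      have "(\<Sum>k\<in>UNIV. c k \<phi> * ?J $ k)
          = (\<Sum>k\<in>UNIV. c k \<phi> * I0 $ k + (if k = j then c k \<phi> * (e / 2) else 0))"
        by (rule sum.cong) (auto simp: axis_def algebra_simps)
      then show ?thesis by (simp add: sum.distrib)
    qed
    from val[OF J, of \<phi>] val[OF I0, of \<phi>] have "a j \<phi> * (e / 2) = a' j \<phi> * (e / 2)"
      unfolding shift by linarith
    then show ?thesis using e by simp
  qed
  then have a: "a = a'" by (intro ext)
  moreover have "b = b'"
    using val[OF I0] a by (intro ext) simp
  ultimately show ?thesis by simp
qed

lemma quantization_eq:
  assumes "domain V" and "affine_form V f a b"
  shows "quantization V lam f = coeff_operator lam a b"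
proof -
  have "(THE (a, b). affine_form V f a b) = (a, b)"
    by (rule the_equality) (use assms affine_form_unique in \<open>fastforce+\<close>)
  then show ?thesis by (simp add: quantization_def)
qed

definition equivalent_reps ::
  "((real^'m) \<times> (real^'m) \<Rightarrow> real) set \<Rightarrow>
   (((real^'m) \<times> (real^'m) \<Rightarrow> real) \<Rightarrow> (real^'m \<Rightarrow> complex) \<Rightarrow> (real^'m \<Rightarrow> complex)) \<Rightarrow>
   (((real^'m) \<times> (real^'m) \<Rightarrow> real) \<Rightarrow> (real^'m \<Rightarrow> complex) \<Rightarrow> (real^'m \<Rightarrow> complex)) \<Rightarrow> bool" where
  "equivalent_reps A Q Q' \<longleftrightarrow>
     (\<exists>U. unitary_operator U \<and> (\<forall>f\<in>A. \<forall>\<rho>\<in>torus_smooth. U (Q f \<rho>) = Q' f (U \<rho>)))"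

end

theory Submission
  imports Defs
begin

text \<open>The operator of \<open>f = a\<^sup>k I\<^sub>k + b\<close> is \<open>-\<i> X + w\<close>, where \<open>X\<close> is the vector field with components \<open>a\<^sup>k\<close>
  and \<open>w = b - a\<^sup>k \<lambda>\<^sub>k - (\<i>/2) div X\<close>. Symmetry is integration by parts on the torus. The bracket of two
  such functions has as its vector field the Lie bracket \<open>[X, X']\<close>, and since
  \<open>div [X, X'] = X (div X') - X' (div X)\<close>, its \<open>w\<close> is \<open>X w' - X' w\<close>, which is the Dirac condition.
  Trigonometric polynomials are uniformly dense by Stone-Weierstrass on the image of the torus under
  \<open>\<phi> \<mapsto> (exp (\<i> \<phi>\<^sup>k))\<close>, which gives completeness of the Fourier modes by Bessel's inequality.
  An intertwining operator maps the constant mode to a nonzero periodic function with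
  \<open>\<partial>\<^sub>k g = \<i> (\<lambda>'\<^sub>k - \<lambda>\<^sub>k) g\<close>, which forces \<open>\<lambda>'\<^sub>k - \<lambda>\<^sub>k\<close> to be an integer.\<close>

section \<open>Calculus of smooth functions\<close>

text \<open>On an open set the derivative at a point sees only nearby values. The rules below
  replace \<open>frechet_derivative\<close> by sum, product or chain formulas valid on
  \<open>S\<close>; this lemma moves smoothness across such formulas.\<close>

lemma Ck_on_cong:
  assumes "open S" "\<And>x. x \<in> S \<Longrightarrow> f x = g x"
  shows "Ck_on n S f \<longleftrightarrow> Ck_on n S g"
  using assms(2)
proof (induction n arbitrary: f g)
  case 0
  then show ?case by (simp cong: continuous_on_cong)
next
  case (Suc n)
  have has: "(f has_derivative D) (at x) \<longleftrightarrow> (g has_derivative D) (at x)" if "x \<in> S" for x D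
    using has_derivative_transform_within_open[OF _ \<open>open S\<close> that] Suc.prems by metis
  then have "frechet_derivative f (at x) = frechet_derivative g (at x)" if "x \<in> S" for x
    using that by (simp add: frechet_derivative_def)
  then have "Ck_on n S (\<lambda>x. frechet_derivative f (at x) v) \<longleftrightarrow>
      Ck_on n S (\<lambda>x. frechet_derivative g (at x) v)" for v
    by (intro Suc.IH) simp
  then show ?case using has by (simp add: differentiable_def)
qed

lemma Ck_on_Suc_imp: "Ck_on (Suc n) S f \<Longrightarrow> Ck_on n S f"
proof (induction n arbitrary: f)
  case 0
  then show ?case
    by (auto intro!: continuous_at_imp_continuous_on differentiable_imp_continuous_within)
next
  case (Suc n)
  then show ?case by (metis Ck_on.simps(2))
qed

lemma Ck_on_const: "Ck_on n S (\<lambda>x. c)"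
  by (induction n arbitrary: c) auto

lemma Ck_on_add:
  assumes "open S" "Ck_on n S f" "Ck_on n S g"
  shows "Ck_on n S (\<lambda>x. f x + g x)"
  using assms(2,3)
proof (induction n arbitrary: f g)
  case 0
  then show ?case by (simp add: continuous_on_add)
next
  case (Suc n)
  have "frechet_derivative (\<lambda>x. f x + g x) (at x) v =
      frechet_derivative f (at x) v + frechet_derivative g (at x) v" if "x \<in> S" for x v
    using Suc.prems that
    by (subst frechet_derivative_at[OF has_derivative_add, symmetric])
      (auto simp: frechet_derivative_works)
  then have "Ck_on n S (\<lambda>x. frechet_derivative (\<lambda>x. f x + g x) (at x) v)" for v
    using Suc.IH Suc.prems by (subst Ck_on_cong[OF \<open>open S\<close>]) auto
  then show ?case using Suc.prems by simp
qed

lemma Ck_on_bounded_linear: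
  assumes L: "bounded_linear L" and "open S" "Ck_on n S f"
  shows "Ck_on n S (\<lambda>x. L (f x))"
  using assms(3)
proof (induction n arbitrary: f)
  case 0
  then show ?case by (simp add: bounded_linear.continuous_on[OF L])
next
  case (Suc n)
  have has: "((\<lambda>x. L (f x)) has_derivative (\<lambda>v. L (frechet_derivative f (at x) v))) (at x)"
    if "x \<in> S" for x
    using Suc.prems that
    by (auto intro!: bounded_linear.has_derivative[OF L] simp: frechet_derivative_works)
  then have "Ck_on n S (\<lambda>x. frechet_derivative (\<lambda>x. L (f x)) (at x) v)" for v
    using Suc.IH Suc.prems
    by (subst Ck_on_cong[OF \<open>open S\<close>, where g="\<lambda>x. L (frechet_derivative f (at x) v)"])
      (auto simp: frechet_derivative_at[OF has, symmetric])
  then show ?case using has by (auto simp: differentiable_def)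
qed

text \<open>With a linear inner map, the derivative in direction \<open>v\<close> is the derivative
  of \<open>f\<close> in the fixed direction \<open>h v\<close>, again composed with
  \<open>h\<close>, so the induction stays within one family of functions.\<close>

lemma Ck_on_compose_bounded_linear:
  assumes h: "bounded_linear h" and "open S" and hS: "h ` S \<subseteq> T" and "Ck_on n T f"
  shows "Ck_on n S (\<lambda>x. f (h x))"
  using assms(4)
proof (induction n arbitrary: f)
  case 0
  then show ?case
    using continuous_on_compose2[OF _ bounded_linear.continuous_on[OF h continuous_on_id] hS]
    by simp
next
  case (Suc n)
  have has: "((\<lambda>x. f (h x)) has_derivative (\<lambda>v. frechet_derivative f (at (h x)) (h v))) (at x)"
    if "x \<in> S" for x
  proof (rule has_derivative_compose[of h h])
    show "(h has_derivative h) (at x)"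
      by (rule bounded_linear_imp_has_derivative[OF h])
    show "(f has_derivative frechet_derivative f (at (h x))) (at (h x))"
      using Suc.prems that hS by (auto simp: frechet_derivative_works[symmetric])
  qed
  then have "Ck_on n S (\<lambda>x. frechet_derivative (\<lambda>x. f (h x)) (at x) v)" for v
    using Suc.IH[of "\<lambda>y. frechet_derivative f (at y) (h v)"] Suc.prems
    by (subst Ck_on_cong[OF \<open>open S\<close>, where g="\<lambda>x. frechet_derivative f (at (h x)) (h v)"])
      (auto simp: frechet_derivative_at[OF has, symmetric])
  then show ?case using has by (auto simp: differentiable_def)
qed

text \<open>Treats products and scalar multiplication at once. In each term of the Leibniz rule one
  factor stays undifferentiated; \<open>Ck_on_Suc_imp\<close> lowers it to order \<open>n\<close>
  before the induction hypothesis applies.\<close>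

lemma Ck_on_bounded_bilinear:
  assumes "bounded_bilinear B" and "open S" "Ck_on n S f" "Ck_on n S g"
  shows "Ck_on n S (\<lambda>x. B (f x) (g x))"
proof -
  interpret bounded_bilinear B by fact
  show ?thesis using assms(3,4)
  proof (induction n arbitrary: f g)
    case 0
    then show ?case by (simp add: continuous_on)
  next
    case (Suc n)
    have has: "((\<lambda>x. B (f x) (g x)) has_derivative
        (\<lambda>v. B (f x) (frechet_derivative g (at x) v) + B (frechet_derivative f (at x) v) (g x)))
        (at x)" if "x \<in> S" for x
      using Suc.prems that by (intro FDERIV) (auto simp: frechet_derivative_works)
    have "Ck_on n S (\<lambda>x. B (f x) (frechet_derivative g (at x) v)
          + B (frechet_derivative f (at x) v) (g x))" for v
      using Suc.IH Suc.prems Ck_on_Suc_imp[OF Suc.prems(1)] Ck_on_Suc_imp[OF Suc.prems(2)]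
      by (intro Ck_on_add[OF \<open>open S\<close>]) auto
    then have "Ck_on n S (\<lambda>x. frechet_derivative (\<lambda>x. B (f x) (g x)) (at x) v)" for v
      by (subst Ck_on_cong[OF \<open>open S\<close>,
          where g="\<lambda>x. B (f x) (frechet_derivative g (at x) v) + B (frechet_derivative f (at x) v) (g x)"])
        (auto simp: frechet_derivative_at[OF has, symmetric])
    then show ?case using has by (auto simp: differentiable_def)
  qed
qed

lemma smooth_on_cong:
  "open S \<Longrightarrow> (\<And>x. x \<in> S \<Longrightarrow> f x = g x) \<Longrightarrow> smooth_on S f \<longleftrightarrow> smooth_on S g"
  unfolding smooth_on_def using Ck_on_cong by blast

lemma smooth_on_const: "smooth_on S (\<lambda>x. c)"
  by (simp add: smooth_on_def Ck_on_const)

lemma smooth_on_add: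
  "open S \<Longrightarrow> smooth_on S f \<Longrightarrow> smooth_on S g \<Longrightarrow> smooth_on S (\<lambda>x. f x + g x)"
  by (simp add: smooth_on_def Ck_on_add)

lemma smooth_on_sum:
  "open S \<Longrightarrow> (\<And>i. i \<in> F \<Longrightarrow> smooth_on S (f i)) \<Longrightarrow> smooth_on S (\<lambda>x. \<Sum>i\<in>F. f i x)"
  by (induction F rule: infinite_finite_induct) (auto intro: smooth_on_const smooth_on_add)

lemma smooth_on_bounded_linear:
  "bounded_linear L \<Longrightarrow> open S \<Longrightarrow> smooth_on S f \<Longrightarrow> smooth_on S (\<lambda>x. L (f x))"
  by (simp add: smooth_on_def Ck_on_bounded_linear)

lemma smooth_on_compose_bounded_linear:
  "bounded_linear h \<Longrightarrow> open S \<Longrightarrow> h ` S \<subseteq> T \<Longrightarrow> smooth_on T f \<Longrightarrow> smooth_on S (\<lambda>x. f (h x))"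
  by (simp add: smooth_on_def Ck_on_compose_bounded_linear)

lemma smooth_on_mult:
  fixes f g :: "'a::real_normed_vector \<Rightarrow> 'b::real_normed_algebra"
  shows "open S \<Longrightarrow> smooth_on S f \<Longrightarrow> smooth_on S g \<Longrightarrow> smooth_on S (\<lambda>x. f x * g x)"
  by (simp add: smooth_on_def Ck_on_bounded_bilinear[OF bounded_bilinear_mult])

lemma smooth_on_bounded_linear_self:
  assumes "bounded_linear L" "open S" shows "smooth_on S L"
proof -
  have "Ck_on n S (\<lambda>x. x)" for n
    by (induction n) (auto intro: Ck_on_const)
  then show ?thesis
    using smooth_on_bounded_linear[OF assms, of "\<lambda>x. x"] by (simp add: smooth_on_def)
qed

lemma smooth_on_imp_differentiable: "smooth_on S f \<Longrightarrow> x \<in> S \<Longrightarrow> f differentiable at x"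
  unfolding smooth_on_def by (metis Ck_on.simps(2))

lemma smooth_on_imp_continuous_on: "smooth_on S f \<Longrightarrow> continuous_on S f"
  unfolding smooth_on_def by (metis Ck_on.simps(1))

lemma smooth_on_frechet_derivative:
  "smooth_on S f \<Longrightarrow> smooth_on S (\<lambda>x. frechet_derivative f (at x) v)"
  unfolding smooth_on_def by (metis Ck_on.simps(2))


section \<open>Smooth functions on the torus\<close>

lemma torus_smoothD:
  assumes "g \<in> torus_smooth"
  shows "smooth_on UNIV g" "g (\<phi> + axis k (2 * pi)) = g \<phi>" "g differentiable at x"
    "continuous_on S g"
  using assms unfolding torus_smooth_def
  by (auto intro: smooth_on_imp_differentiable
      continuous_on_subset[OF smooth_on_imp_continuous_on])

lemma torus_smooth_has_derivative:
  "g \<in> torus_smooth \<Longrightarrow> (g has_derivative frechet_derivative g (at x)) (at x)"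
  using torus_smoothD(3) frechet_derivative_works by blast

lemma torus_smooth_const: "(\<lambda>\<phi>. c) \<in> torus_smooth"
  by (simp add: torus_smooth_def smooth_on_const)

lemma torus_smooth_add:
  "f \<in> torus_smooth \<Longrightarrow> g \<in> torus_smooth \<Longrightarrow> (\<lambda>\<phi>. f \<phi> + g \<phi>) \<in> torus_smooth"
  by (simp add: torus_smooth_def smooth_on_add)

lemma torus_smooth_sum:
  "(\<And>i. i \<in> F \<Longrightarrow> f i \<in> torus_smooth) \<Longrightarrow> (\<lambda>\<phi>. \<Sum>i\<in>F. f i \<phi>) \<in> torus_smooth"
  by (simp add: torus_smooth_def smooth_on_sum)

lemma torus_smooth_bounded_linear:
  "bounded_linear L \<Longrightarrow> f \<in> torus_smooth \<Longrightarrow> (\<lambda>\<phi>. L (f \<phi>)) \<in> torus_smooth"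
  by (simp add: torus_smooth_def smooth_on_bounded_linear)

lemma torus_smooth_mult:
  fixes f g :: "real^'m \<Rightarrow> 'b::real_normed_algebra"
  shows "f \<in> torus_smooth \<Longrightarrow> g \<in> torus_smooth \<Longrightarrow> (\<lambda>\<phi>. f \<phi> * g \<phi>) \<in> torus_smooth"
  by (simp add: torus_smooth_def smooth_on_mult)

lemma torus_smooth_scaleR:
  "a \<in> torus_smooth \<Longrightarrow> f \<in> torus_smooth \<Longrightarrow> (\<lambda>\<phi>. a \<phi> *\<^sub>R f \<phi>) \<in> torus_smooth"
  by (simp add: torus_smooth_def smooth_on_def Ck_on_bounded_bilinear[OF bounded_bilinear_scaleR])

lemma torus_smooth_uminus: "f \<in> torus_smooth \<Longrightarrow> (\<lambda>\<phi>. - f \<phi>) \<in> torus_smooth"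
  by (rule torus_smooth_bounded_linear[OF bounded_linear_minus[OF bounded_linear_ident]])

lemma torus_smooth_diff:
  "f \<in> torus_smooth \<Longrightarrow> g \<in> torus_smooth \<Longrightarrow> (\<lambda>\<phi>. f \<phi> - g \<phi>) \<in> torus_smooth"
  using torus_smooth_add[of f "\<lambda>\<phi>. - g \<phi>"] by (simp add: torus_smooth_uminus)

lemma torus_smooth_of_real:
  "f \<in> torus_smooth \<Longrightarrow> (\<lambda>\<phi>. complex_of_real (f \<phi>)) \<in> torus_smooth"
  by (rule torus_smooth_bounded_linear[OF bounded_linear_of_real])

lemma torus_smooth_cnj: "f \<in> torus_smooth \<Longrightarrow> (\<lambda>\<phi>. cnj (f \<phi>)) \<in> torus_smooth"
  by (rule torus_smooth_bounded_linear[OF bounded_linear_cnj])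

text \<open>Both sides are derivatives at \<open>\<phi>\<close> of the same function, since
  \<open>g\<close> equals its own translate.\<close>

lemma frechet_derivative_periodic:
  assumes "g \<in> torus_smooth"
  shows "frechet_derivative g (at (\<phi> + axis k (2 * pi))) = frechet_derivative g (at \<phi>)"
proof -
  have "((\<lambda>\<psi>. g (\<psi> + axis k (2 * pi))) has_derivative
      (\<lambda>v. frechet_derivative g (at (\<phi> + axis k (2 * pi))) v)) (at \<phi>)"
    by (rule has_derivative_compose[of "\<lambda>\<psi>. \<psi> + axis k (2 * pi)" "\<lambda>v. v"])
      (auto intro!: derivative_eq_intros torus_smooth_has_derivative assms)
  then show ?thesis
    using frechet_derivative_at by (simp add: torus_smoothD(2)[OF assms])
qed

lemma torus_smooth_partial: "g \<in> torus_smooth \<Longrightarrow> partial k g \<in> torus_smooth"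
  using smooth_on_frechet_derivative[of UNIV g "axis k 1"]
  by (simp add: torus_smooth_def partial_def[abs_def] frechet_derivative_periodic[unfolded torus_smooth_def])

lemmas torus_smooth_intros = torus_smooth_const torus_smooth_add torus_smooth_sum torus_smooth_mult
  torus_smooth_diff torus_smooth_uminus torus_smooth_of_real torus_smooth_cnj torus_smooth_partial

lemma partial_eq: "(g has_derivative D) (at \<phi>) \<Longrightarrow> partial k g \<phi> = D (axis k 1)"
  by (metis frechet_derivative_at partial_def)

lemma partial_const: "partial k (\<lambda>\<phi>. c) \<phi> = 0"
  by (simp add: partial_def)

lemma partial_add:
  assumes "f \<in> torus_smooth" "g \<in> torus_smooth"
  shows "partial k (\<lambda>\<phi>. f \<phi> + g \<phi>) \<phi> = partial k f \<phi> + partial k g \<phi>"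
  using partial_eq[OF has_derivative_add[OF assms[THEN torus_smooth_has_derivative]]]
  by (simp add: partial_def)

lemma partial_bounded_linear:
  assumes "bounded_linear L" "f \<in> torus_smooth"
  shows "partial k (\<lambda>\<phi>. L (f \<phi>)) \<phi> = L (partial k f \<phi>)"
  using partial_eq[OF bounded_linear.has_derivative[OF assms(1) torus_smooth_has_derivative[OF assms(2)]]]
  by (simp add: partial_def)

lemma partial_mult:
  fixes f g :: "real^'m \<Rightarrow> 'b::real_normed_algebra"
  assumes "f \<in> torus_smooth" "g \<in> torus_smooth"
  shows "partial k (\<lambda>\<phi>. f \<phi> * g \<phi>) \<phi> = f \<phi> * partial k g \<phi> + partial k f \<phi> * g \<phi>"
  using partial_eq[OF has_derivative_mult[OF assms[THEN torus_smooth_has_derivative]]]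
  by (simp add: partial_def)

lemma partial_scaleR:
  assumes "a \<in> torus_smooth" "f \<in> torus_smooth"
  shows "partial k (\<lambda>\<phi>. a \<phi> *\<^sub>R f \<phi>) \<phi> = a \<phi> *\<^sub>R partial k f \<phi> + partial k a \<phi> *\<^sub>R f \<phi>"
  using partial_eq[OF has_derivative_scaleR[OF assms[THEN torus_smooth_has_derivative]]]
  by (simp add: partial_def)

lemma partial_sum:
  assumes "finite F" "\<And>i. i \<in> F \<Longrightarrow> f i \<in> torus_smooth"
  shows "partial k (\<lambda>\<phi>. \<Sum>i\<in>F. f i \<phi>) \<phi> = (\<Sum>i\<in>F. partial k (f i) \<phi>)"
  using assms by (induction F rule: finite_induct)
    (auto simp: partial_const partial_add torus_smooth_sum)

lemma partial_uminus: "f \<in> torus_smooth \<Longrightarrow> partial k (\<lambda>\<phi>. - f \<phi>) \<phi> = - partial k f \<phi>"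
  by (rule partial_bounded_linear[OF bounded_linear_minus[OF bounded_linear_ident]])

lemma partial_diff:
  assumes "f \<in> torus_smooth" "g \<in> torus_smooth"
  shows "partial k (\<lambda>\<phi>. f \<phi> - g \<phi>) \<phi> = partial k f \<phi> - partial k g \<phi>"
  using partial_add[OF assms(1) torus_smooth_uminus[OF assms(2)]] partial_uminus[OF assms(2)]
  by simp

lemma partial_of_real:
  "f \<in> torus_smooth \<Longrightarrow> partial k (\<lambda>\<phi>. complex_of_real (f \<phi>)) \<phi> = of_real (partial k f \<phi>)"
  by (rule partial_bounded_linear[OF bounded_linear_of_real])

lemma partial_cnj: "f \<in> torus_smooth \<Longrightarrow> partial k (\<lambda>\<phi>. cnj (f \<phi>)) \<phi> = cnj (partial k f \<phi>)"
  by (rule partial_bounded_linear[OF bounded_linear_cnj])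

section \<open>Integration over the torus\<close>

abbreviation torus_box :: "(real^'m) set" where
  "torus_box \<equiv> cbox 0 (\<chi> k. 2 * pi)"

text \<open>Translation moves the box along one coordinate; periodicity carries the part beyond 2 pi
  back to the part vacated near 0.\<close>

lemma torus_integral_translate:
  fixes g :: "real^'m \<Rightarrow> 'b::banach"
  assumes cont: "continuous_on UNIV g" and per: "\<And>\<phi>. g (\<phi> + axis k (2 * pi)) = g \<phi>"
    and t: "0 \<le> t" "t \<le> 2 * pi"
  shows "integral torus_box (\<lambda>\<phi>. g (\<phi> + axis k t)) = integral torus_box g"
proof -
  \<comment> \<open>All sides other than the \<open>k\<close>-th stay [0, 2 pi], so translations
    along \<open>k\<close> and cuts at a height of the \<open>k\<close>-th coordinate remain in this
    family.\<close>
  define slab :: "real \<Rightarrow> real \<Rightarrow> (real^'m) set"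
    where "slab s u = cbox (axis k s) (\<chi> j. if j = k then u else 2 * pi)" for s u
  have mem: "x \<in> slab s u \<longleftrightarrow> (\<forall>j. if j = k then s \<le> x $ j \<and> x $ j \<le> u else 0 \<le> x $ j \<and> x $ j \<le> 2 * pi)"
    for x s u
    unfolding slab_def mem_box_cart by (auto simp: axis_def)
  have split: "integral (slab s w) g = integral (slab s u) g + integral (slab u w) g"
    if "s \<le> u" "u \<le> w" for s u w
  proof -
    have "slab s w \<inter> {x. x \<bullet> axis k 1 \<le> u} = slab s u" "slab s w \<inter> {x. x \<bullet> axis k 1 \<ge> u} = slab u w"
      using that by (auto simp: mem inner_axis split: if_splits) (smt (verit))+
    moreover have "g integrable_on slab s w"
      unfolding slab_def by (rule integrable_continuous) (rule continuous_on_subset[OF cont], simp)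
    then have "integral (slab s w) g = integral (slab s w \<inter> {x. x \<bullet> axis k 1 \<le> u}) g
        + integral (slab s w \<inter> {x. x \<bullet> axis k 1 \<ge> u}) g"
      unfolding slab_def by (rule integral_split) (simp add: axis_in_Basis_iff)
    ultimately show ?thesis by simp
  qed
  have shift: "integral (slab s u) (\<lambda>x. g (x + axis k r)) = integral (slab (s + r) (u + r)) g" for s u r
  proof -
    have "axis k (s + r) - axis k r = axis k s"
      "(\<chi> j. if j = k then u + r else 2 * pi) - axis k r = (\<chi> j. if j = k then u else 2 * pi)"
      by (auto simp: vec_eq_iff axis_def)
    then show ?thesis
      using integral_shift_cbox[of "axis k (s + r)" "axis k r" "\<chi> j. if j = k then u + r else 2 * pi" g]
      by (simp add: slab_def)
  qed
  have tb: "torus_box = slab 0 (2 * pi)"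
    by (auto simp: mem mem_box_cart)
  \<comment> \<open>The cut is at height 2 pi, where the translated box
    \<open>slab t (2 * pi + t)\<close> leaves the original one.\<close>
  have "integral torus_box (\<lambda>\<phi>. g (\<phi> + axis k t)) = integral (slab t (2 * pi)) g + integral (slab (2 * pi) (2 * pi + t)) g"
    using split[of t "2 * pi" "2 * pi + t"] t by (simp add: tb shift)
  also have "integral (slab (2 * pi) (2 * pi + t)) g = integral (slab 0 t) g"
    using shift[of 0 t "2 * pi"] by (simp add: per add.commute)
  also have "integral (slab t (2 * pi)) g + integral (slab 0 t) g = integral torus_box g"
    using split[of 0 t "2 * pi"] t by (simp add: tb)
  finally show ?thesis .
qed

text \<open>The arbitrary set \<open>S\<close> covers both uses: the fundamental theorem on
  [0, 2 pi] and a constancy argument on the whole line.\<close>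

lemma has_vector_derivative_partial:
  assumes "g \<in> torus_smooth"
  shows "((\<lambda>t. g (\<phi> + axis k t)) has_vector_derivative partial k g (\<phi> + axis k t)) (at t within S)"
proof -
  have ax: "axis k s = s *\<^sub>R axis k (1::real)" for s
    by (auto simp: vec_eq_iff axis_def)
  have lin: "linear (frechet_derivative g (at x))" for x
    using torus_smoothD(3)[OF assms] by (rule linear_frechet_derivative)
  have "((\<lambda>t. g (\<phi> + t *\<^sub>R axis k 1)) has_derivative
      (\<lambda>s. frechet_derivative g (at (\<phi> + t *\<^sub>R axis k 1)) (s *\<^sub>R axis k 1))) (at t within S)"
    by (rule has_derivative_compose[of "\<lambda>t. \<phi> + t *\<^sub>R axis k 1" "\<lambda>s. s *\<^sub>R axis k 1"])
      (auto intro!: derivative_eq_intros torus_smooth_has_derivative assms)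
  then show ?thesis
    by (simp add: has_vector_derivative_def partial_def ax[symmetric] linear_scale[OF lin, symmetric])
qed

text \<open>The average of \<open>\<partial>\<^sub>k g\<close> over all translates along the \<open>k\<close>-th circle vanishes pointwise, and
  every translate has the same integral.\<close>

lemma torus_integral_partial:
  fixes g :: "real^'m \<Rightarrow> 'b::banach"
  assumes g: "g \<in> torus_smooth"
  shows "integral torus_box (partial k g) = 0"
proof -
  let ?h = "\<lambda>t \<phi>. partial k g (\<phi> + axis k t)"
  have p: "partial k g \<in> torus_smooth"
    using g by (rule torus_smooth_partial)
  \<comment> \<open>Exchanging the integrals lets the inner one run along the \<open>k\<close>-th
    circle, where the fundamental theorem applies.\<close>
  have "integral (cbox 0 (2 * pi)) (\<lambda>t. integral torus_box (?h t)) =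
      integral torus_box (\<lambda>\<phi>. integral (cbox 0 (2 * pi)) (\<lambda>t. ?h t \<phi>))"
  proof (rule integral_swap_continuous)
    have "continuous_on UNIV (\<lambda>z. snd z + fst z *\<^sub>R axis k (1::real))"
      by (intro continuous_intros)
    also have "(\<lambda>z. snd z + fst z *\<^sub>R axis k (1::real)) = (\<lambda>z. snd z + axis k (fst z))"
      by (auto simp: fun_eq_iff vec_eq_iff axis_def)
    finally have "continuous_on UNIV (\<lambda>z. snd z + axis k (fst z :: real))" .
    then have "continuous_on UNIV (\<lambda>z. ?h (fst z) (snd z))"
      by (rule continuous_on_compose2[OF torus_smoothD(4)[OF p, of UNIV]]) auto
    then show "continuous_on (cbox (0, 0) (2 * pi, \<chi> k. 2 * pi)) (\<lambda>(t, \<phi>). ?h t \<phi>)"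
      by (simp add: case_prod_unfold continuous_on_subset[OF _ subset_UNIV])
  qed
  \<comment> \<open>This is the value at the lower endpoint; the upper one agrees with it by
    periodicity, so the inner integral vanishes.\<close>
  moreover have "g (\<phi> + axis k 0) = g \<phi>" for \<phi>
    by (metis add.right_neutral axis_eq_0_iff)
  then have "integral (cbox 0 (2 * pi)) (\<lambda>t. ?h t \<phi>) = 0" for \<phi>
    using fundamental_theorem_of_calculus[of 0 "2 * pi" "\<lambda>t. g (\<phi> + axis k t)" "\<lambda>t. ?h t \<phi>"]
      has_vector_derivative_partial[OF g] torus_smoothD(2)[OF g]
    by (simp add: integral_unique)
  moreover have "integral (cbox 0 (2 * pi)) (\<lambda>t. integral torus_box (?h t))
      = integral (cbox 0 (2 * pi)) (\<lambda>t. integral torus_box (partial k g))"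
    by (rule integral_cong)
      (simp add: torus_integral_translate torus_smoothD(2)[OF p] torus_smoothD(4)[OF p])
  ultimately show ?thesis by simp
qed

lemma torus_smooth_integrable:
  fixes f :: "real^'m \<Rightarrow> 'b::banach"
  shows "f \<in> torus_smooth \<Longrightarrow> f integrable_on torus_box"
  by (intro integrable_continuous torus_smoothD(4))

section \<open>The Hermitian form and integration by parts\<close>

lemma torus_inner_add_left:
  assumes "f \<in> torus_smooth" "f' \<in> torus_smooth" "g \<in> torus_smooth"
  shows "torus_inner (\<lambda>\<phi>. f \<phi> + f' \<phi>) g = torus_inner f g + torus_inner f' g"
proof -
  have "integral torus_box (\<lambda>\<phi>. f \<phi> * cnj (g \<phi>) + f' \<phi> * cnj (g \<phi>)) =
      integral torus_box (\<lambda>\<phi>. f \<phi> * cnj (g \<phi>)) + integral torus_box (\<lambda>\<phi>. f' \<phi> * cnj (g \<phi>))"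
    using assms by (intro integral_add torus_smooth_integrable torus_smooth_intros)
  then show ?thesis
    by (simp add: torus_inner_def distrib_right add_divide_distrib)
qed

lemma torus_inner_mult_left: "torus_inner (\<lambda>\<phi>. c * f \<phi>) g = c * torus_inner f g"
  by (simp add: torus_inner_def mult.assoc)

lemma torus_inner_cnj: "torus_inner g f = cnj (torus_inner f g)"
  unfolding torus_inner_def by (simp add: integral_cnj mult.commute)

lemma torus_inner_add_right:
  assumes "f \<in> torus_smooth" "f' \<in> torus_smooth" "g \<in> torus_smooth"
  shows "torus_inner g (\<lambda>\<phi>. f \<phi> + f' \<phi>) = torus_inner g f + torus_inner g f'"
  using torus_inner_add_left[OF assms] by (metis torus_inner_cnj complex_cnj_add)

lemma torus_inner_mult_right: "torus_inner g (\<lambda>\<phi>. c * f \<phi>) = cnj c * torus_inner g f"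
  by (metis torus_inner_cnj complex_cnj_mult torus_inner_mult_left)

lemma torus_inner_diff_left:
  assumes "f \<in> torus_smooth" "f' \<in> torus_smooth" "g \<in> torus_smooth"
  shows "torus_inner (\<lambda>\<phi>. f \<phi> - f' \<phi>) g = torus_inner f g - torus_inner f' g"
  using torus_inner_add_left[OF assms(1) torus_smooth_uminus[OF assms(2)] assms(3)]
    torus_inner_mult_left[of "-1" f' g] by simp

lemma torus_inner_sum_left:
  assumes "finite F" "\<And>i. i \<in> F \<Longrightarrow> f i \<in> torus_smooth" "g \<in> torus_smooth"
  shows "torus_inner (\<lambda>\<phi>. \<Sum>i\<in>F. f i \<phi>) g = (\<Sum>i\<in>F. torus_inner (f i) g)"
  using assms(1,2)
proof (induction F rule: finite_induct)
  case empty
  then show ?case by (simp add: torus_inner_def)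
next
  case (insert i F)
  then show ?case by (simp add: torus_inner_add_left torus_smooth_sum assms(3))
qed

text \<open>Shows that the form is real on the diagonal, so \<open>Re\<close> in
  \<open>torus_norm\<close> loses nothing, and prepares positivity and definiteness through the
  squared modulus.\<close>

lemma torus_inner_self:
  fixes f :: "real^'m \<Rightarrow> complex"
  assumes "f \<in> torus_smooth"
  shows "torus_inner f f = of_real (integral torus_box (\<lambda>\<phi>. (cmod (f \<phi>))\<^sup>2) / (2 * pi) ^ CARD('m))"
proof -
  have "(\<lambda>\<phi>. (cmod (f \<phi>))\<^sup>2) integrable_on torus_box"
    by (intro integrable_continuous continuous_intros torus_smoothD(4)[OF assms])
  then have "((complex_of_real \<circ> (\<lambda>\<phi>. (cmod (f \<phi>))\<^sup>2)) has_integral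
      of_real (integral torus_box (\<lambda>\<phi>. (cmod (f \<phi>))\<^sup>2))) torus_box"
    by (intro has_integral_linear integrable_integral bounded_linear_of_real)
  then have "((\<lambda>\<phi>. f \<phi> * cnj (f \<phi>)) has_integral of_real (integral torus_box (\<lambda>\<phi>. (cmod (f \<phi>))\<^sup>2))) torus_box"
    unfolding complex_norm_square[symmetric] by (simp add: o_def)
  then show ?thesis
    by (simp add: torus_inner_def integral_unique)
qed

lemma torus_volume: "measure lborel (torus_box :: (real^'m) set) = (2 * pi) ^ CARD('m)"
proof -
  have "0 \<in> torus_box"
    by (simp add: mem_box_cart)
  then show ?thesis
    by (subst content_cbox_cart) auto
qed

lemma torus_inner_self_nonneg:
  fixes f :: "real^'m \<Rightarrow> complex"
  assumes "f \<in> torus_smooth" shows "0 \<le> Re (torus_inner f f)"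
proof -
  have "0 \<le> integral torus_box (\<lambda>\<phi>. (cmod (f \<phi>))\<^sup>2)"
    by (intro integral_nonneg integrable_continuous continuous_intros torus_smoothD(4)[OF assms]) auto
  then show ?thesis
    unfolding torus_inner_self[OF assms] by simp
qed

text \<open>The normalised torus has total volume one, so a uniform bound passes to the norm with
  the same constant.\<close>

lemma torus_inner_self_le:
  fixes f :: "real^'m \<Rightarrow> complex"
  assumes "f \<in> torus_smooth" "\<And>\<phi>. \<phi> \<in> torus_box \<Longrightarrow> cmod (f \<phi>) \<le> e"
  shows "Re (torus_inner f f) \<le> e\<^sup>2"
proof -
  have "integral torus_box (\<lambda>\<phi>. (cmod (f \<phi>))\<^sup>2) \<le> integral torus_box (\<lambda>\<phi>::real^'m. e\<^sup>2)"
    using assms(2)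
    by (intro integral_le power_mono integrable_continuous continuous_intros torus_smoothD(4)[OF assms(1)]) auto
  also have "\<dots> = e\<^sup>2 * (2 * pi) ^ CARD('m)"
    by (simp only: integral_const torus_volume real_scaleR_def) (rule mult.commute)
  finally show ?thesis
    by (simp only: torus_inner_self[OF assms(1)] Re_complex_of_real) (simp add: divide_le_eq)
qed

text \<open>The product of \<open>f\<close> with the conjugate of \<open>g\<close> is periodic, so
  its partial derivative integrates to zero.\<close>

lemma torus_inner_partial:
  assumes f: "f \<in> torus_smooth" and g: "g \<in> torus_smooth"
  shows "torus_inner (partial k f) g = - torus_inner f (partial k g)"
proof -
  let ?p = "\<lambda>\<phi>. f \<phi> * cnj (partial k g \<phi>)" and ?q = "\<lambda>\<phi>. partial k f \<phi> * cnj (g \<phi>)"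
  have "partial k (\<lambda>\<phi>. f \<phi> * cnj (g \<phi>)) = (\<lambda>\<phi>. ?p \<phi> + ?q \<phi>)"
    using f g by (auto simp: partial_mult torus_smooth_cnj partial_cnj)
  moreover have "integral torus_box (partial k (\<lambda>\<phi>. f \<phi> * cnj (g \<phi>))) = 0"
    using f g by (intro torus_integral_partial torus_smooth_intros)
  ultimately have "integral torus_box ?p + integral torus_box ?q = 0"
    using f g by (subst integral_add[symmetric]) (auto intro!: torus_smooth_integrable torus_smooth_intros)
  then have "integral torus_box ?q = - integral torus_box ?p"
    by (simp add: add_eq_0_iff)
  then show ?thesis
    by (simp add: torus_inner_def)
qed


section \<open>Fourier series\<close>

lemma fourier_mode_eq: "fourier_mode n \<phi> = exp (\<i> * of_real ((\<chi> r. of_int (n $ r)) \<bullet> \<phi>))"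
  by (simp add: fourier_mode_def inner_vec_def)

lemma fourier_mode_has_derivative:
  "(fourier_mode n has_derivative
     (\<lambda>v. \<i> * of_real ((\<chi> r. of_int (n $ r)) \<bullet> v) * fourier_mode n \<phi>)) (at \<phi>)"
proof -
  let ?L = "\<lambda>v. \<i> * complex_of_real ((\<chi> r. of_int (n $ r)) \<bullet> v)"
  have "(?L has_derivative ?L) (at \<phi>)"
    by (auto intro!: derivative_eq_intros)
  then show ?thesis
    using has_derivative_compose[OF _ DERIV_exp[unfolded has_field_derivative_def]]
    unfolding fourier_mode_eq[abs_def] by (fastforce simp: mult_ac)
qed

lemma fourier_mode_smooth: "fourier_mode n \<in> torus_smooth"
proof -
  \<comment> \<open>The factor \<open>c\<close> is arbitrary because each directional derivative of
    a multiple of the mode is another multiple of the same mode.\<close>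
  have "Ck_on j UNIV (\<lambda>\<phi>. c * fourier_mode n \<phi>)" for j c
  proof (induction j arbitrary: c)
    case 0
    show ?case unfolding fourier_mode_eq Ck_on.simps by (intro continuous_intros)
  next
    case (Suc j)
    have has: "((\<lambda>\<phi>. c * fourier_mode n \<phi>) has_derivative
        (\<lambda>v. c * \<i> * of_real ((\<chi> r. of_int (n $ r)) \<bullet> v) * fourier_mode n \<phi>)) (at \<phi>)" for \<phi>
      using has_derivative_mult_right[OF fourier_mode_has_derivative] by (simp add: mult.assoc)
    show ?case
      using has Suc.IH by (auto simp: differentiable_def frechet_derivative_at[OF has, symmetric])
  qed
  from this[of _ 1] have "smooth_on UNIV (fourier_mode n)"
    by (simp add: smooth_on_def)
  moreover have "fourier_mode n (\<phi> + axis k (2 * pi)) = fourier_mode n \<phi>" for k \<phi>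
  proof -
    have "exp (\<i> * (of_int (n $ k) * (of_real pi * 2))) = 1"
      using exp_integer_2pi[of "of_int (n $ k)"] by (simp add: mult_ac)
    then show ?thesis
      by (simp add: fourier_mode_eq inner_add_right inner_axis distrib_left exp_add mult_ac)
  qed
  ultimately show ?thesis by (simp add: torus_smooth_def)
qed

lemma partial_fourier_mode: "partial k (fourier_mode n) \<phi> = \<i> * of_int (n $ k) * fourier_mode n \<phi>"
  using partial_eq[OF fourier_mode_has_derivative] by (simp add: inner_axis)

lemma fourier_mode_zero: "fourier_mode 0 = (\<lambda>\<phi>. 1)"
  by (simp add: fourier_mode_def fun_eq_iff)

text \<open>Distinct modes differ in some frequency \<open>n $ k\<close>; integrating by parts in
  that direction multiplies the inner product by two different eigenvalues, so it is zero.\<close>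

lemma torus_inner_fourier_mode:
  "torus_inner (fourier_mode n) (fourier_mode n' :: real^'m \<Rightarrow> complex) = (if n = n' then 1 else 0)"
proof (cases "n = n'")
  case True
  then show ?thesis
    by (simp add: torus_inner_self fourier_mode_smooth torus_volume) (simp add: fourier_mode_def torus_volume)
next
  case False
  then obtain k where k: "n $ k \<noteq> n' $ k"
    by (auto simp: vec_eq_iff)
  let ?I = "torus_inner (fourier_mode n) (fourier_mode n')"
  have "\<i> * of_int (n $ k) * ?I = - cnj (\<i> * of_int (n' $ k)) * ?I"
    using torus_inner_partial[of "fourier_mode n" "fourier_mode n'" k]
    by (simp add: fourier_mode_smooth partial_fourier_mode[abs_def] torus_inner_mult_left torus_inner_mult_right)
  then have "?I = 0" using k by simp
  then show ?thesis using False by simp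
qed

text \<open>Generating the span of the modes inductively gives an induction principle, by which
  closure under products reduces to \<open>fourier_mode_add\<close>.\<close>

inductive_set trig_polynomials :: "(real^'m \<Rightarrow> complex) set" where
  mode: "fourier_mode n \<in> trig_polynomials"
| scale: "P \<in> trig_polynomials \<Longrightarrow> (\<lambda>\<phi>. c * P \<phi>) \<in> trig_polynomials"
| add: "P \<in> trig_polynomials \<Longrightarrow> Q \<in> trig_polynomials \<Longrightarrow> (\<lambda>\<phi>. P \<phi> + Q \<phi>) \<in> trig_polynomials"

lemma trig_polynomials_smooth: "P \<in> trig_polynomials \<Longrightarrow> P \<in> torus_smooth"
  by (induction rule: trig_polynomials.induct)
    (auto intro: fourier_mode_smooth torus_smooth_intros)

lemma trig_polynomials_const: "(\<lambda>\<phi>. c) \<in> trig_polynomials"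
  using trig_polynomials.scale[OF trig_polynomials.mode[of 0], of c] by (simp add: fourier_mode_zero)

lemma trig_polynomials_sum:
  "(\<And>i. i \<in> F \<Longrightarrow> f i \<in> trig_polynomials) \<Longrightarrow> (\<lambda>\<phi>. \<Sum>i\<in>F. f i \<phi>) \<in> trig_polynomials"
  by (induction F rule: infinite_finite_induct)
    (auto intro: trig_polynomials_const trig_polynomials.add)

lemma fourier_mode_add: "fourier_mode (n + n') \<phi> = fourier_mode n \<phi> * fourier_mode n' \<phi>"
  by (simp add: fourier_mode_def distrib_left distrib_right sum.distrib exp_add)

lemma trig_polynomials_mult:
  assumes "P \<in> trig_polynomials" "Q \<in> trig_polynomials"
  shows "(\<lambda>\<phi>. P \<phi> * Q \<phi>) \<in> trig_polynomials"
  using assms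
proof (induction rule: trig_polynomials.induct)
  case (mode n)
  then show ?case
  proof (induction rule: trig_polynomials.induct)
    case (mode n')
    then show ?case using trig_polynomials.mode[of "n + n'"] by (simp add: fourier_mode_add[abs_def])
  next
    case (scale P c)
    then show ?case using trig_polynomials.scale by (simp add: mult.left_commute)
  next
    case (add P Q)
    then show ?case using trig_polynomials.add by (simp add: distrib_left)
  qed
next
  case (scale P c)
  then show ?case using trig_polynomials.scale by (simp add: mult.assoc)
next
  case (add P Q)
  then show ?case using trig_polynomials.add by (simp add: distrib_right)
qed

section \<open>Partial sums and Bessel's inequality\<close>

definition fourier_sum :: "(int^'m) set \<Rightarrow> (real^'m \<Rightarrow> complex) \<Rightarrow> real^'m \<Rightarrow> complex" where
  "fourier_sum F \<rho> = (\<lambda>\<phi>. \<Sum>n\<in>F. torus_inner \<rho> (fourier_mode n) * fourier_mode n \<phi>)"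

lemma fourier_sum_smooth: "fourier_sum F \<rho> \<in> torus_smooth"
  unfolding fourier_sum_def by (intro torus_smooth_intros fourier_mode_smooth)

lemma fourier_sum_mult: "fourier_sum F (\<lambda>\<phi>. c * f \<phi>) = (\<lambda>\<phi>. c * fourier_sum F f \<phi>)"
  by (simp add: fourier_sum_def torus_inner_mult_left sum_distrib_left mult.assoc)

lemma fourier_sum_add:
  "f \<in> torus_smooth \<Longrightarrow> g \<in> torus_smooth \<Longrightarrow>
    fourier_sum F (\<lambda>\<phi>. f \<phi> + g \<phi>) = (\<lambda>\<phi>. fourier_sum F f \<phi> + fourier_sum F g \<phi>)"
  by (simp add: fourier_sum_def torus_inner_add_left fourier_mode_smooth distrib_right sum.distrib)

lemma fourier_sum_diff:
  "f \<in> torus_smooth \<Longrightarrow> g \<in> torus_smooth \<Longrightarrow>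
    fourier_sum F (\<lambda>\<phi>. f \<phi> - g \<phi>) = (\<lambda>\<phi>. fourier_sum F f \<phi> - fourier_sum F g \<phi>)"
  by (simp add: fourier_sum_def torus_inner_diff_left fourier_mode_smooth left_diff_distrib sum_subtractf)

text \<open>Quantifying over all larger finite sets allows the frequency sets of two summands to be
  joined, and supplies the threshold that convergence along \<open>finite_subsets_at_top\<close>
  asks for.\<close>

lemma fourier_sum_trig_polynomial:
  assumes "P \<in> trig_polynomials"
  shows "\<exists>F. finite F \<and> (\<forall>F'. finite F' \<longrightarrow> F \<subseteq> F' \<longrightarrow> fourier_sum F' P = P)"
  using assms
proof (induction rule: trig_polynomials.induct)
  case (mode n)
  have "fourier_sum F' (fourier_mode n) = fourier_mode n" if "finite F'" "{n} \<subseteq> F'" for F'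
    using that by (auto simp: fourier_sum_def torus_inner_fourier_mode mult_delta_left sum.delta cong: if_cong)
  then show ?case by (intro exI[of _ "{n}"]) simp
next
  case (scale P c)
  then obtain F where "finite F" "\<And>F'. finite F' \<Longrightarrow> F \<subseteq> F' \<Longrightarrow> fourier_sum F' P = P"
    by blast
  then show ?case by (intro exI[of _ F]) (simp add: fourier_sum_mult)
next
  case (add P Q)
  then obtain F G where "finite F" "\<And>F'. finite F' \<Longrightarrow> F \<subseteq> F' \<Longrightarrow> fourier_sum F' P = P"
    "finite G" "\<And>F'. finite F' \<Longrightarrow> G \<subseteq> F' \<Longrightarrow> fourier_sum F' Q = Q" by blast
  then show ?case
    using add.hyps by (intro exI[of _ "F \<union> G"]) (auto simp: fourier_sum_add trig_polynomials_smooth)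
qed

text \<open>Splits \<open>d\<close> into its projection \<open>s\<close> and the remainder
  \<open>r\<close>. The remainder is orthogonal to every mode in \<open>F\<close>, hence to
  \<open>s\<close>, and Pythagoras gives the bound.\<close>

lemma bessel_inequality:
  assumes d: "d \<in> torus_smooth" and F: "finite F"
  shows "Re (torus_inner (\<lambda>\<phi>. d \<phi> - fourier_sum F d \<phi>) (\<lambda>\<phi>. d \<phi> - fourier_sum F d \<phi>)) \<le> Re (torus_inner d d)"
proof -
  define s where "s = fourier_sum F d"
  define r where "r = (\<lambda>\<phi>. d \<phi> - s \<phi>)"
  have s: "s \<in> torus_smooth" unfolding s_def by (rule fourier_sum_smooth)
  have r: "r \<in> torus_smooth" unfolding r_def using d s by (intro torus_smooth_intros)
  have sn: "torus_inner s (fourier_mode n) = torus_inner d (fourier_mode n)" if "n \<in> F" for n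
    using that F
    by (simp add: s_def fourier_sum_def torus_inner_sum_left torus_smooth_intros fourier_mode_smooth
        torus_inner_mult_left torus_inner_fourier_mode if_distrib[of "\<lambda>x. _ * x"] sum.delta cong: if_cong)
  have rn: "torus_inner r (fourier_mode n) = 0" if "n \<in> F" for n
    using d s sn[OF that] by (simp add: r_def torus_inner_diff_left fourier_mode_smooth)
  have "torus_inner s r = (\<Sum>n\<in>F. torus_inner d (fourier_mode n) * torus_inner (fourier_mode n) r)"
    using F r by (simp add: s_def fourier_sum_def torus_inner_sum_left torus_smooth_intros
        fourier_mode_smooth torus_inner_mult_left)
  also have "\<dots> = 0"
    using rn by (intro sum.neutral) (metis complex_cnj_zero mult_zero_right torus_inner_cnj)
  finally have sr: "torus_inner s r = 0" .
  then have rs: "torus_inner r s = 0"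
    by (metis complex_cnj_zero torus_inner_cnj)
  have "d = (\<lambda>\<phi>. r \<phi> + s \<phi>)" by (simp add: r_def)
  then have "torus_inner d d = torus_inner (\<lambda>\<phi>. r \<phi> + s \<phi>) (\<lambda>\<phi>. r \<phi> + s \<phi>)" by metis
  also have "\<dots> = torus_inner r r + torus_inner s s"
    using r s by (simp add: torus_inner_add_left torus_inner_add_right torus_smooth_add sr rs)
  finally show ?thesis
    using torus_inner_self_nonneg[OF s] by (simp add: r_def s_def)
qed

section \<open>Density of trigonometric polynomials\<close>

definition circles :: "real^'m \<Rightarrow> complex^'m" where
  "circles \<phi> = (\<chi> k. cis (\<phi> $ k))"

text \<open>Euler's formulas, with the frequencies \<open>axis k 1\<close> and
  \<open>axis k (- 1)\<close>.\<close>

lemma trig_polynomials_cos_sin: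
  "(\<lambda>\<phi>::real^'m. complex_of_real (cos (\<phi> $ k))) \<in> trig_polynomials"
  "(\<lambda>\<phi>::real^'m. complex_of_real (sin (\<phi> $ k))) \<in> trig_polynomials"
proof -
  let ?e = "fourier_mode (axis k 1)" and ?e' = "fourier_mode (axis k (- 1))"
  have s: "(\<Sum>r\<in>UNIV. of_int (axis k c $ r) * \<phi> $ r) = of_int c * \<phi> $ k" for c and \<phi> :: "real^'m"
    by (simp add: axis_def if_distrib[of of_int] mult_delta_left sum.delta cong: if_cong)
  have e: "?e \<phi> = cis (\<phi> $ k)" "?e' \<phi> = cis (- (\<phi> $ k))" for \<phi>
    by (simp_all add: fourier_mode_def s cis_conv_exp)
  have "(\<lambda>\<phi>. (1/2) * (?e \<phi> + ?e' \<phi>)) \<in> trig_polynomials"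
    "(\<lambda>\<phi>. (- \<i>/2) * (?e \<phi> + (- 1) * ?e' \<phi>)) \<in> trig_polynomials"
    by (intro trig_polynomials.intros)+
  moreover have "(1/2) * (?e \<phi> + ?e' \<phi>) = complex_of_real (cos (\<phi> $ k))"
    "(- \<i>/2) * (?e \<phi> + (- 1) * ?e' \<phi>) = complex_of_real (sin (\<phi> $ k))" for \<phi>
    by (simp_all add: e complex_eq_iff)
  ultimately show "(\<lambda>\<phi>::real^'m. complex_of_real (cos (\<phi> $ k))) \<in> trig_polynomials"
    "(\<lambda>\<phi>::real^'m. complex_of_real (sin (\<phi> $ k))) \<in> trig_polynomials" by simp_all
qed

text \<open>Real polynomials are generated by constants and real-linear functionals. On
  \<open>circles \<phi>\<close> such a functional is a real combination of cosines and sines, with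
  coefficients its values at \<open>axis k 1\<close> and \<open>axis k \<i>\<close>.\<close>

lemma trig_polynomials_real_polynomial:
  fixes p :: "complex^'m \<Rightarrow> real"
  assumes "real_polynomial_function p"
  shows "(\<lambda>\<phi>. complex_of_real (p (circles \<phi>))) \<in> trig_polynomials"
  using assms
proof (induction rule: real_polynomial_function.induct)
  case (linear f)
  interpret bounded_linear f by fact
  have "f (circles \<phi>) = (\<Sum>k\<in>UNIV. f (axis k 1) * cos (\<phi> $ k) + f (axis k \<i>) * sin (\<phi> $ k))" for \<phi>
  proof -
    have "circles \<phi> = (\<Sum>k\<in>UNIV. cos (\<phi> $ k) *\<^sub>R axis k 1 + sin (\<phi> $ k) *\<^sub>R axis k \<i>)"
      unfolding vec_eq_iff
      by (auto simp: circles_def sum.distrib axis_def if_distrib[of "\<lambda>x. _ *\<^sub>R x"] sum.delta complex_eq_iff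
          cong: if_cong)
    then show ?thesis by (simp add: sum add scaleR mult.commute)
  qed
  then show ?case
    by (simp, intro trig_polynomials_sum trig_polynomials.add trig_polynomials.scale trig_polynomials_cos_sin)
next
  case (const c)
  then show ?case by (rule trig_polynomials_const)
next
  case (add f g)
  then show ?case using trig_polynomials.add by simp
next
  case (mult f g)
  then show ?case using trig_polynomials_mult by simp
qed

text \<open>Iterates the one-step period of the definition: natural multiples, then integer
  multiples, then one coordinate after another.\<close>

lemma torus_smooth_periodic:
  assumes g: "g \<in> torus_smooth" and per: "\<And>k. \<exists>i::int. \<psi> $ k = \<phi> $ k + 2 * pi * of_int i"
  shows "g \<psi> = g \<phi>"
proof -
  have ax: "axis k (x + y) = axis k x + axis k (y::real)" for k x y
    by (auto simp: vec_eq_iff axis_def)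
  have nat: "g (\<theta> + axis k (2 * pi * real n)) = g \<theta>" for \<theta> k n
  proof (induction n)
    case 0
    then show ?case by (metis add.right_neutral axis_eq_0_iff mult_zero_right of_nat_0)
  next
    case (Suc n)
    have "\<theta> + axis k (2 * pi * real (Suc n)) = (\<theta> + axis k (2 * pi * real n)) + axis k (2 * pi)"
      by (simp add: ax[symmetric] add.assoc distrib_left add.commute)
    then show ?case using Suc torus_smoothD(2)[OF g] by metis
  qed
  have int: "g (\<theta> + axis k (2 * pi * of_int i)) = g \<theta>" for \<theta> k i
  proof (cases i rule: int_cases2)
    case (nonneg n)
    then show ?thesis using nat by simp
  next
    case (nonpos n)
    \<comment> \<open>A negative shift is undone by the opposite positive one, to which
      \<open>nat\<close> applies.\<close>
    have "\<theta> + axis k (2 * pi * of_int i) + axis k (2 * pi * real n) = \<theta> + axis k 0"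
      by (simp only: add.assoc ax[symmetric] nonpos) simp
    moreover have "\<theta> + axis k 0 = \<theta>" by (metis add.right_neutral axis_eq_0_iff)
    ultimately show ?thesis using nat by metis
  qed
  obtain z where z: "\<And>k. \<psi> $ k = \<phi> $ k + 2 * pi * of_int (z k)"
    using per by metis
  have "g (\<phi> + (\<Sum>k\<in>F. axis k (2 * pi * of_int (z k)))) = g \<phi>" if "finite F" for F
    using that
  proof (induction F rule: finite_induct)
    case (insert k F)
    then show ?case
      using int[of "\<phi> + (\<Sum>k\<in>F. axis k (2 * pi * of_int (z k)))" k "z k"]
      by (simp add: add.assoc) (simp add: add.commute)
  qed simp
  moreover have "\<psi> = \<phi> + (\<Sum>k\<in>UNIV. axis k (2 * pi * of_int (z k)))"
    by (simp add: vec_eq_iff z axis_def sum.delta)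
  ultimately show ?thesis by simp
qed

lemma trig_polynomials_dense:
  fixes \<rho> :: "real^'m \<Rightarrow> complex"
  assumes \<rho>: "\<rho> \<in> torus_smooth" and "e > 0"
  shows "\<exists>P\<in>trig_polynomials. \<forall>\<phi>\<in>torus_box. cmod (\<rho> \<phi> - P \<phi>) < e"
proof -
  define K :: "(complex^'m) set" where "K = circles ` torus_box"
  \<comment> \<open>Descends \<open>\<rho>\<close> to the image \<open>K\<close> of the torus. The
    chosen preimage does not matter, as points with equal image differ by multiples of 2 pi in each
    coordinate.\<close>
  define f where "f v = \<rho> (SOME \<phi>. \<phi> \<in> torus_box \<and> circles \<phi> = v)" for v
  have f: "f (circles \<phi>) = \<rho> \<phi>" if "\<phi> \<in> torus_box" for \<phi>
  proof -
    define \<psi> where "\<psi> = (SOME \<psi>. \<psi> \<in> torus_box \<and> circles \<psi> = circles \<phi>)"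
    have "circles \<psi> = circles \<phi>"
      unfolding \<psi>_def using someI[of "\<lambda>\<psi>. \<psi> \<in> torus_box \<and> circles \<psi> = circles \<phi>" \<phi>] that by blast
    then have "cis (\<psi> $ k) = cis (\<phi> $ k)" for k
      by (simp add: circles_def vec_eq_iff)
    then have "sin (\<psi> $ k) = sin (\<phi> $ k) \<and> cos (\<psi> $ k) = cos (\<phi> $ k)" for k
      by (simp add: complex_eq_iff)
    then have "\<rho> \<psi> = \<rho> \<phi>"
      by (intro torus_smooth_periodic[OF \<rho>]) (simp add: sin_cos_eq_iff)
    then show ?thesis by (simp add: f_def \<psi>_def)
  qed
  have cont_circles: "continuous_on S (circles :: real^'m \<Rightarrow> _)" for S
    unfolding circles_def by (intro continuous_intros)
  have "compact K"
    unfolding K_def by (intro compact_continuous_image cont_circles compact_cbox)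
  \<comment> \<open>\<open>circles\<close> acts as a quotient map: the preimage of a closed set
    under \<open>f\<close> is the image of a compact part of the box, hence closed.\<close>
  moreover have "continuous_on K f"
    unfolding continuous_on_closed_vimage[OF compact_imp_closed[OF \<open>compact K\<close>]]
  proof (intro allI impI)
    fix B :: "complex set" assume "closed B"
    have "f -` B \<inter> K = circles ` (torus_box \<inter> \<rho> -` B)"
      using f by (auto simp: K_def)
    moreover have "compact (torus_box \<inter> \<rho> -` B)"
      using \<open>closed B\<close> torus_smoothD(4)[OF \<rho>, of UNIV]
      by (intro compact_Int_closed compact_cbox continuous_closed_vimage)
        (auto simp: continuous_on_eq_continuous_at[OF open_UNIV])
    ultimately show "closed (f -` B \<inter> K)"
      by (metis compact_continuous_image compact_imp_closed cont_circles)
  qed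
  ultimately obtain g where g: "polynomial_function g" "\<And>v. v \<in> K \<Longrightarrow> cmod (f v - g v) < e"
    using Stone_Weierstrass_polynomial_function[of K f e] \<open>e > 0\<close> by auto
  have "real_polynomial_function (\<lambda>v. Re (g v))" "real_polynomial_function (\<lambda>v. Im (g v))"
    using g(1) bounded_linear_Re bounded_linear_Im by (auto simp: polynomial_function_def o_def)
  then have "(\<lambda>\<phi>. complex_of_real (Re (g (circles \<phi>))) + \<i> * complex_of_real (Im (g (circles \<phi>)))) \<in> trig_polynomials"
    by (intro trig_polynomials.add trig_polynomials.scale) (auto dest: trig_polynomials_real_polynomial)
  then have "(\<lambda>\<phi>. g (circles \<phi>)) \<in> trig_polynomials"
    by (simp add: complex_eq[symmetric])
  moreover have "cmod (\<rho> \<phi> - g (circles \<phi>)) < e" if "\<phi> \<in> torus_box" for \<phi>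
    using g(2)[of "circles \<phi>"] f[OF that] that by (simp add: K_def)
  ultimately show ?thesis by (intro bexI[of _ "\<lambda>\<phi>. g (circles \<phi>)"]) auto
qed

text \<open>Once \<open>F\<close> contains the frequencies of an approximating polynomial
  \<open>P\<close>, the remainder of \<open>\<rho>\<close> equals that of \<open>\<rho> - P\<close>,
  and \<open>bessel_inequality\<close> bounds it by the norm of \<open>\<rho> - P\<close>.\<close>

lemma fourier_sum_tendsto:
  fixes \<rho> :: "real^'m \<Rightarrow> complex"
  assumes \<rho>: "\<rho> \<in> torus_smooth"
  shows "((\<lambda>F. torus_norm (\<lambda>\<phi>. \<rho> \<phi> - fourier_sum F \<rho> \<phi>)) \<longlongrightarrow> 0) (finite_subsets_at_top UNIV)"
proof (rule tendstoI)
  fix e :: real assume "e > 0"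
  \<comment> \<open>The uniform bound yields a non-strict norm bound; halving \<open>e\<close>
    restores strictness.\<close>
  then obtain P where P: "P \<in> trig_polynomials" "\<And>\<phi>. \<phi> \<in> torus_box \<Longrightarrow> cmod (\<rho> \<phi> - P \<phi>) < e / 2"
    using trig_polynomials_dense[OF \<rho>, of "e / 2"] by auto
  define d where "d = (\<lambda>\<phi>. \<rho> \<phi> - P \<phi>)"
  have d: "d \<in> torus_smooth"
    unfolding d_def by (rule torus_smooth_diff[OF \<rho> trig_polynomials_smooth[OF P(1)]])
  obtain F0 where F0: "finite F0" "\<And>F. finite F \<Longrightarrow> F0 \<subseteq> F \<Longrightarrow> fourier_sum F P = P"
    using fourier_sum_trig_polynomial[OF P(1)] by blast
  have "torus_norm (\<lambda>\<phi>. \<rho> \<phi> - fourier_sum F \<rho> \<phi>) \<le> e / 2" if "finite F" "F0 \<subseteq> F" for F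
  proof -
    let ?r = "\<lambda>\<phi>. d \<phi> - fourier_sum F d \<phi>"
    have "(\<lambda>\<phi>. \<rho> \<phi> - fourier_sum F \<rho> \<phi>) = ?r"
      using F0(2)[OF that] fourier_sum_diff[OF \<rho> trig_polynomials_smooth[OF P(1)], of F]
      by (simp add: d_def)
    moreover have "Re (torus_inner ?r ?r) \<le> (e / 2)\<^sup>2"
      using bessel_inequality[OF d \<open>finite F\<close>] torus_inner_self_le[OF d, of "e / 2"] P(2)
      by (force simp: d_def intro: less_imp_le)
    moreover have "sqrt (Re (torus_inner ?r ?r)) \<le> e / 2"
      using calculation(2) \<open>e > 0\<close> by (intro real_le_lsqrt) auto
    ultimately show ?thesis
      by (simp add: torus_norm_def)
  qed
  then show "\<forall>\<^sub>F F in finite_subsets_at_top UNIV.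
      dist (torus_norm (\<lambda>\<phi>. \<rho> \<phi> - fourier_sum F \<rho> \<phi>)) 0 < e"
    using \<open>e > 0\<close> F0(1) torus_inner_self_nonneg[OF torus_smooth_diff[OF \<rho> fourier_sum_smooth]]
    unfolding eventually_finite_subsets_at_top
    by (intro exI[of _ F0]) (force simp: torus_norm_def)
qed

lemma orthonormal_basis_fourier_mode: "orthonormal_basis (fourier_mode :: int^'m \<Rightarrow> _)"
  using fourier_sum_tendsto
  by (auto simp: orthonormal_basis_def fourier_mode_smooth torus_inner_fourier_mode fourier_sum_def)

text \<open>Uniqueness of Fourier coefficients: all partial sums vanish, so completeness forces norm
  zero, and continuity turns this into pointwise vanishing.\<close>

lemma torus_smooth_eq_zero:
  fixes h :: "real^'m \<Rightarrow> complex"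
  assumes h: "h \<in> torus_smooth" and 0: "\<And>n. torus_inner h (fourier_mode n) = 0"
  shows "h \<phi> = 0"
proof -
  have "fourier_sum F h = (\<lambda>\<phi>. 0)" for F
    by (simp add: fourier_sum_def 0)
  then have "((\<lambda>F::(int^'m) set. torus_norm h) \<longlongrightarrow> 0) (finite_subsets_at_top UNIV)"
    using fourier_sum_tendsto[OF h] by simp
  then have "torus_norm h = 0"
    by (simp add: tendsto_const_iff)
  then have "integral torus_box (\<lambda>\<phi>. (cmod (h \<phi>))\<^sup>2) = 0"
    by (simp add: torus_norm_def torus_inner_self[OF h])
  \<comment> \<open>Nonempty interior of the box is what lets a zero integral of a continuous
    nonnegative function force vanishing on the whole closed box.\<close>
  moreover have "box 0 (\<chi> k. 2 * pi) \<noteq> ({} :: (real^'m) set)"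
    by (auto simp: mem_box_cart intro!: exI[of _ "\<chi> k. pi"] simp flip: ex_in_conv)
  ultimately have z: "h \<psi> = 0" if "\<psi> \<in> torus_box" for \<psi>
    using integral_cbox_eq_0_iff[of 0 "\<chi> k. 2 * pi" "\<lambda>\<phi>. (cmod (h \<phi>))\<^sup>2"] that
    by (simp add: continuous_on_power continuous_on_norm torus_smoothD(4)[OF h])
  \<comment> \<open>The representative of \<open>\<phi>\<close> modulo 2 pi inside the box.\<close>
  define \<psi> where "\<psi> = (\<chi> k. 2 * pi * frac (\<phi> $ k / (2 * pi)))"
  have "\<phi> $ k = \<psi> $ k + 2 * pi * of_int \<lfloor>\<phi> $ k / (2 * pi)\<rfloor>" for k
    by (simp add: \<psi>_def frac_def algebra_simps)
  then have "h \<phi> = h \<psi>"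
    by (intro torus_smooth_periodic[OF h]) blast
  moreover have "\<psi> \<in> torus_box"
    by (auto simp: \<psi>_def mem_box_cart frac_ge_0 mult_le_cancel_left1 less_imp_le[OF frac_lt_1])
  ultimately show ?thesis using z by simp
qed

text \<open>Both mixed partial derivatives have the same Fourier coefficients.\<close>

lemma partial_commute_complex:
  fixes \<rho> :: "real^'m \<Rightarrow> complex"
  assumes \<rho>: "\<rho> \<in> torus_smooth"
  shows "partial j (partial k \<rho>) \<phi> = partial k (partial j \<rho>) \<phi>"
proof -
  have coeff: "torus_inner (partial k f) (fourier_mode n) = \<i> * of_int (n $ k) * torus_inner f (fourier_mode n)"
    if "f \<in> torus_smooth" for f :: "real^'m \<Rightarrow> complex" and k n
    using that by (simp add: torus_inner_partial fourier_mode_smooth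
        partial_fourier_mode[abs_def] torus_inner_mult_right)
  let ?h = "\<lambda>\<phi>. partial j (partial k \<rho>) \<phi> - partial k (partial j \<rho>) \<phi>"
  have "?h \<in> torus_smooth"
    using \<rho> by (intro torus_smooth_diff torus_smooth_partial)
  moreover have "torus_inner ?h (fourier_mode n) = 0" for n
    using \<rho> by (simp add: torus_inner_diff_left torus_smooth_partial fourier_mode_smooth coeff)
  ultimately show ?thesis
    using torus_smooth_eq_zero[of ?h \<phi>] by simp
qed

text \<open>The embedding \<open>of_real\<close> commutes with partial derivatives and is injective,
  so the complex case transfers.\<close>

lemma partial_commute_real:
  fixes a :: "real^'m \<Rightarrow> real"
  assumes "a \<in> torus_smooth"
  shows "partial j (partial k a) \<phi> = partial k (partial j a) \<phi>"
proof -
  have "partial k (\<lambda>\<phi>. complex_of_real (a \<phi>)) = (\<lambda>\<phi>. of_real (partial k a \<phi>))" for k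
    using assms by (intro ext partial_of_real)
  then have "complex_of_real (partial j (partial k a) \<phi>) = of_real (partial k (partial j a) \<phi>)"
    using partial_commute_complex[of "\<lambda>\<phi>. of_real (a \<phi>)" j k \<phi>] assms
    by (simp add: partial_of_real torus_smooth_intros)
  then show ?thesis by simp
qed


section \<open>Vector fields on the torus\<close>

text \<open>The vector field with components \<open>a\<close> as a derivation. The codomain is left
  open since it acts on real coefficients as well as on complex functions.\<close>

definition along ::
  "('m \<Rightarrow> real^'m \<Rightarrow> real) \<Rightarrow> (real^'m \<Rightarrow> 'b::real_normed_vector) \<Rightarrow> real^'m \<Rightarrow> 'b" where
  "along a f \<phi> = (\<Sum>k\<in>UNIV. a k \<phi> *\<^sub>R partial k f \<phi>)"

definition divergence :: "('m \<Rightarrow> real^'m \<Rightarrow> real) \<Rightarrow> real^'m \<Rightarrow> real" where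
  "divergence a \<phi> = (\<Sum>k\<in>UNIV. partial k (a k) \<phi>)"

definition lie_bracket ::
  "('m \<Rightarrow> real^'m \<Rightarrow> real) \<Rightarrow> ('m \<Rightarrow> real^'m \<Rightarrow> real) \<Rightarrow> 'm \<Rightarrow> real^'m \<Rightarrow> real" where
  "lie_bracket a a' j \<phi> = along a (a' j) \<phi> - along a' (a j) \<phi>"

lemma along_smooth:
  "(\<And>k. a k \<in> torus_smooth) \<Longrightarrow> f \<in> torus_smooth \<Longrightarrow> along a f \<in> torus_smooth"
  unfolding along_def[abs_def] by (intro torus_smooth_sum torus_smooth_scaleR torus_smooth_partial)

lemma divergence_smooth: "(\<And>k. a k \<in> torus_smooth) \<Longrightarrow> divergence a \<in> torus_smooth"
  unfolding divergence_def[abs_def] by (intro torus_smooth_sum torus_smooth_partial)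

lemma lie_bracket_smooth:
  "(\<And>k. a k \<in> torus_smooth) \<Longrightarrow> (\<And>k. a' k \<in> torus_smooth) \<Longrightarrow> lie_bracket a a' j \<in> torus_smooth"
  unfolding lie_bracket_def[abs_def] by (intro torus_smooth_diff along_smooth)

lemma along_add:
  "f \<in> torus_smooth \<Longrightarrow> g \<in> torus_smooth \<Longrightarrow>
    along a (\<lambda>\<phi>. f \<phi> + g \<phi>) \<phi> = along a f \<phi> + along a g \<phi>"
  by (simp add: along_def partial_add scaleR_add_right sum.distrib)

lemma along_diff:
  "f \<in> torus_smooth \<Longrightarrow> g \<in> torus_smooth \<Longrightarrow>
    along a (\<lambda>\<phi>. f \<phi> - g \<phi>) \<phi> = along a f \<phi> - along a g \<phi>"
  by (simp add: along_def partial_diff scaleR_diff_right sum_subtractf)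

lemma along_mult:
  fixes f g :: "real^'m \<Rightarrow> 'b::real_normed_algebra"
  shows "f \<in> torus_smooth \<Longrightarrow> g \<in> torus_smooth \<Longrightarrow>
    along a (\<lambda>\<phi>. f \<phi> * g \<phi>) \<phi> = f \<phi> * along a g \<phi> + along a f \<phi> * g \<phi>"
  by (simp add: along_def partial_mult scaleR_add_right sum.distrib sum_distrib_left sum_distrib_right)

lemma along_const: "along a (\<lambda>\<phi>. c) \<phi> = 0"
  by (simp add: along_def partial_const)

lemma along_of_real:
  "f \<in> torus_smooth \<Longrightarrow> along a (\<lambda>\<phi>. complex_of_real (f \<phi>)) \<phi> = of_real (along a f \<phi>)"
  by (simp add: along_def partial_of_real scaleR_conv_of_real)

lemma along_sum:
  "finite F \<Longrightarrow> (\<And>i. i \<in> F \<Longrightarrow> f i \<in> torus_smooth) \<Longrightarrow>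
    along a (\<lambda>\<phi>. \<Sum>i\<in>F. f i \<phi>) \<phi> = (\<Sum>i\<in>F. along a (f i) \<phi>)"
  by (simp add: along_def partial_sum scaleR_sum_right sum.swap[of _ F])

text \<open>Separates the second-order part, which is symmetric in the two fields once mixed
  partials commute, from the first-order part that builds the Lie bracket.\<close>

lemma along_along:
  assumes "\<And>k. a' k \<in> torus_smooth" "f \<in> torus_smooth"
  shows "along a (along a' f) \<phi> =
    (\<Sum>k\<in>UNIV. \<Sum>j\<in>UNIV. (a k \<phi> * a' j \<phi>) *\<^sub>R partial k (partial j f) \<phi>)
    + (\<Sum>j\<in>UNIV. along a (a' j) \<phi> *\<^sub>R partial j f \<phi>)"
proof -
  have "partial k (along a' f) \<phi> = (\<Sum>j\<in>UNIV. a' j \<phi> *\<^sub>R partial k (partial j f) \<phi>)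
      + (\<Sum>j\<in>UNIV. partial k (a' j) \<phi> *\<^sub>R partial j f \<phi>)" for k
    using assms unfolding along_def[abs_def]
    by (simp add: partial_sum torus_smooth_scaleR torus_smooth_partial partial_scaleR sum.distrib)
  moreover have "(\<Sum>k\<in>UNIV. a k \<phi> *\<^sub>R (\<Sum>j\<in>UNIV. partial k (a' j) \<phi> *\<^sub>R partial j f \<phi>)) =
      (\<Sum>j\<in>UNIV. along a (a' j) \<phi> *\<^sub>R partial j f \<phi>)"
    unfolding along_def scaleR_sum_right scaleR_sum_left
    by (subst sum.swap) simp
  ultimately show ?thesis
    by (simp add: along_def[of a "along a' f"] scaleR_add_right sum.distrib scaleR_sum_right)
qed

text \<open>The second-order parts cancel in the difference because mixed partial derivatives
  commute.\<close>

lemma along_commutator: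
  fixes \<rho> :: "real^'m \<Rightarrow> complex"
  assumes a: "\<And>k. a k \<in> torus_smooth" and a': "\<And>k. a' k \<in> torus_smooth" and \<rho>: "\<rho> \<in> torus_smooth"
  shows "along a (along a' \<rho>) \<phi> - along a' (along a \<rho>) \<phi> = along (lie_bracket a a') \<rho> \<phi>"
proof -
  have "(\<Sum>k\<in>UNIV. \<Sum>j\<in>UNIV. (a k \<phi> * a' j \<phi>) *\<^sub>R partial k (partial j \<rho>) \<phi>) =
      (\<Sum>k\<in>UNIV. \<Sum>j\<in>UNIV. (a' k \<phi> * a j \<phi>) *\<^sub>R partial k (partial j \<rho>) \<phi>)"
    by (subst sum.swap) (simp add: partial_commute_complex[OF \<rho>] mult.commute)
  then show ?thesis
    by (simp add: along_along a a' \<rho>)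
      (simp add: along_def[of "lie_bracket a a'"] lie_bracket_def scaleR_diff_left sum_subtractf)
qed

text \<open>Besides the derivative of the divergence, each half yields a double sum of products of
  first derivatives. That sum is unchanged when the fields trade places, so it cancels.\<close>

lemma divergence_lie_bracket:
  assumes a: "\<And>k. a k \<in> torus_smooth" and a': "\<And>k. a' k \<in> torus_smooth"
  shows "divergence (lie_bracket a a') \<phi> = along a (divergence a') \<phi> - along a' (divergence a) \<phi>"
proof -
  have *: "(\<Sum>j\<in>UNIV. partial j (along a (a' j)) \<phi>) = along a (divergence a') \<phi>
      + (\<Sum>j\<in>UNIV. \<Sum>k\<in>UNIV. partial j (a k) \<phi> * partial k (a' j) \<phi>)"
    if a: "\<And>k. a k \<in> torus_smooth" and a': "\<And>k. a' k \<in> torus_smooth"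
    for a a' :: "'a \<Rightarrow> real^'a \<Rightarrow> real"
  proof -
    have "partial j (along a (a' j)) \<phi> = along a (partial j (a' j)) \<phi>
        + (\<Sum>k\<in>UNIV. partial j (a k) \<phi> * partial k (a' j) \<phi>)" for j
      unfolding along_def[abs_def]
      by (simp add: partial_sum torus_smooth_mult torus_smooth_partial a a' partial_mult sum.distrib
          partial_commute_real[OF a', of j])
    then show ?thesis
      by (simp add: sum.distrib divergence_def[abs_def] along_sum torus_smooth_partial a')
  qed
  have "(\<Sum>j\<in>UNIV. \<Sum>k\<in>UNIV. partial j (a k) \<phi> * partial k (a' j) \<phi>) =
      (\<Sum>j\<in>UNIV. \<Sum>k\<in>UNIV. partial j (a' k) \<phi> * partial k (a j) \<phi>)"
    by (subst sum.swap) (simp add: mult.commute)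
  moreover have "partial j (lie_bracket a a' j) \<phi> = partial j (along a (a' j)) \<phi> - partial j (along a' (a j)) \<phi>" for j
    unfolding lie_bracket_def[abs_def] using a a' by (intro partial_diff along_smooth)
  ultimately show ?thesis
    using *[of a a', OF a a'] *[of a' a, OF a' a]
    by (simp add: divergence_def[of "lie_bracket a a'"] sum_subtractf)
qed


section \<open>The operators and the Dirac condition\<close>

definition potential :: "real^'m \<Rightarrow> ('m \<Rightarrow> real^'m \<Rightarrow> real) \<Rightarrow> (real^'m \<Rightarrow> real) \<Rightarrow> real^'m \<Rightarrow> real" where
  "potential lam a b \<phi> = b \<phi> - (\<Sum>k\<in>UNIV. a k \<phi> * lam $ k)"

text \<open>The zero-order coefficient of the operator. Its real part multiplies symmetrically; the
  half divergence in its imaginary part corrects the asymmetry of the first-order term.\<close>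

definition weight :: "real^'m \<Rightarrow> ('m \<Rightarrow> real^'m \<Rightarrow> real) \<Rightarrow> (real^'m \<Rightarrow> real) \<Rightarrow> real^'m \<Rightarrow> complex" where
  "weight lam a b \<phi> = of_real (potential lam a b \<phi>) - (\<i> / 2) * of_real (divergence a \<phi>)"

lemma coeff_operator_eq:
  "coeff_operator lam a b \<rho> \<phi> = - \<i> * along a \<rho> \<phi> + weight lam a b \<phi> * \<rho> \<phi>"
  by (simp add: coeff_operator_def along_def weight_def potential_def divergence_def
      scaleR_conv_of_real algebra_simps)

lemma potential_smooth:
  "(\<And>k. a k \<in> torus_smooth) \<Longrightarrow> b \<in> torus_smooth \<Longrightarrow> potential lam a b \<in> torus_smooth"
  unfolding potential_def[abs_def] by (intro torus_smooth_intros)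

lemma weight_smooth:
  "(\<And>k. a k \<in> torus_smooth) \<Longrightarrow> b \<in> torus_smooth \<Longrightarrow> weight lam a b \<in> torus_smooth"
  unfolding weight_def[abs_def] by (intro torus_smooth_intros potential_smooth divergence_smooth)

lemma coeff_operator_smooth:
  assumes "\<And>k. a k \<in> torus_smooth" "b \<in> torus_smooth" "\<rho> \<in> torus_smooth"
  shows "coeff_operator lam a b \<rho> \<in> torus_smooth"
  unfolding coeff_operator_eq[abs_def]
  using assms by (intro torus_smooth_add torus_smooth_mult torus_smooth_const along_smooth weight_smooth)

lemma torus_operator_coeff_operator:
  assumes "\<And>k. a k \<in> torus_smooth" "b \<in> torus_smooth"
  shows "torus_operator (coeff_operator lam a b)"
  unfolding torus_operator_def
  using assms by (auto simp: coeff_operator_smooth fun_eq_iff coeff_operator_eq along_add along_mult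
      torus_smooth_const along_const algebra_simps)

lemma torus_inner_real_mult:
  "torus_inner (\<lambda>\<phi>. of_real (c \<phi>) * f \<phi>) g = torus_inner f (\<lambda>\<phi>. of_real (c \<phi>) * g \<phi>)"
  by (simp add: torus_inner_def mult_ac)

text \<open>The formal adjoint of a vector field \<open>X\<close> is \<open>- X - div X\<close>:
  integration by parts differentiates both \<open>g\<close> and the components of the field.\<close>

lemma torus_inner_along:
  assumes a: "\<And>k. a k \<in> torus_smooth" and f: "f \<in> torus_smooth" and g: "g \<in> torus_smooth"
  shows "torus_inner (along a f) g =
    - torus_inner f (along a g) - torus_inner f (\<lambda>\<phi>. of_real (divergence a \<phi>) * g \<phi>)"
proof -
  have sum_right: "torus_inner f (\<lambda>\<phi>. \<Sum>k\<in>UNIV. h k \<phi>) = (\<Sum>k\<in>UNIV. torus_inner f (h k))"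
    if "\<And>k. h k \<in> torus_smooth" for h :: "'a \<Rightarrow> real^'a \<Rightarrow> complex"
    using torus_inner_sum_left[of UNIV h f] that f by (subst (1 2) torus_inner_cnj) simp
  have k: "torus_inner (\<lambda>\<phi>. of_real (a k \<phi>) * partial k f \<phi>) g =
      - torus_inner f (\<lambda>\<phi>. of_real (a k \<phi>) * partial k g \<phi>)
      - torus_inner f (\<lambda>\<phi>. of_real (partial k (a k) \<phi>) * g \<phi>)" for k
  proof -
    have "torus_inner (\<lambda>\<phi>. of_real (a k \<phi>) * partial k f \<phi>) g =
        - torus_inner f (partial k (\<lambda>\<phi>. of_real (a k \<phi>) * g \<phi>))"
      unfolding torus_inner_real_mult using a f g
      by (intro torus_inner_partial torus_smooth_intros)
    also have "partial k (\<lambda>\<phi>. of_real (a k \<phi>) * g \<phi>) =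
        (\<lambda>\<phi>. of_real (a k \<phi>) * partial k g \<phi> + of_real (partial k (a k) \<phi>) * g \<phi>)"
      using a g by (auto simp: partial_mult partial_of_real torus_smooth_of_real)
    finally show ?thesis
      using a f g by (simp add: torus_inner_add_right torus_smooth_intros)
  qed
  have "torus_inner (along a f) g = (\<Sum>k\<in>UNIV. torus_inner (\<lambda>\<phi>. of_real (a k \<phi>) * partial k f \<phi>) g)"
    unfolding along_def[abs_def] scaleR_conv_of_real
    using a f g by (intro torus_inner_sum_left torus_smooth_intros) auto
  also have "\<dots> = - torus_inner f (along a g) - torus_inner f (\<lambda>\<phi>. of_real (divergence a \<phi>) * g \<phi>)"
    unfolding k along_def[abs_def] scaleR_conv_of_real divergence_def of_real_sum sum_distrib_right
    using a g by (simp add: sum_right torus_smooth_intros sum_subtractf sum_negf)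
  finally show ?thesis .
qed

lemma hermitian_coeff_operator:
  assumes a: "\<And>k. a k \<in> torus_smooth" and b: "b \<in> torus_smooth"
  shows "hermitian_operator (coeff_operator lam a b)"
  unfolding hermitian_operator_def
proof (intro conjI ballI torus_operator_coeff_operator a b)
  fix f g :: "real^'a \<Rightarrow> complex" assume f: "f \<in> torus_smooth" and g: "g \<in> torus_smooth"
  let ?c = "\<lambda>\<rho> \<phi>. of_real (potential lam a b \<phi>) * \<rho> \<phi>" and ?d = "\<lambda>\<rho> \<phi>. of_real (divergence a \<phi>) * \<rho> \<phi>"
  have eq: "coeff_operator lam a b \<rho> = (\<lambda>\<phi>. (- \<i> * along a \<rho> \<phi> + (- \<i> / 2) * ?d \<rho> \<phi>) + ?c \<rho> \<phi>)" for \<rho>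
    by (auto simp: coeff_operator_eq weight_def algebra_simps)
  have smooth: "along a \<rho> \<in> torus_smooth" "?c \<rho> \<in> torus_smooth" "?d \<rho> \<in> torus_smooth"
    if "\<rho> \<in> torus_smooth" for \<rho> :: "real^'a \<Rightarrow> complex"
    using that a b by (auto intro!: torus_smooth_mult torus_smooth_of_real along_smooth potential_smooth divergence_smooth)
  have "torus_inner (coeff_operator lam a b f) g =
      - \<i> * torus_inner (along a f) g + (- \<i> / 2) * torus_inner (?d f) g + torus_inner (?c f) g"
    unfolding eq using smooth[OF f] g
    by (simp only: torus_inner_add_left torus_smooth_add torus_smooth_mult torus_smooth_const torus_inner_mult_left)
  \<comment> \<open>Moving the vector field across produces a full divergence term; the half already
    present turns it into the conjugate half required on the right.\<close>
  also have "\<dots> = cnj (- \<i>) * torus_inner f (along a g) + cnj (- \<i> / 2) * torus_inner f (?d g) + torus_inner f (?c g)"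
    unfolding torus_inner_along[OF a f g] torus_inner_real_mult by (simp add: field_simps)
  also have "\<dots> = torus_inner f (coeff_operator lam a b g)"
    unfolding eq using smooth[OF g] f
    by (simp only: torus_inner_add_right torus_smooth_add torus_smooth_mult torus_smooth_const torus_inner_mult_right)
  finally show "torus_inner (coeff_operator lam a b f) g = torus_inner f (coeff_operator lam a b g)" .
qed

text \<open>Since \<open>lam\<close> is constant, the derivation passes to the components in the
  \<lambda>-term and the real parts match; the imaginary parts match by
  \<open>divergence_lie_bracket\<close>.\<close>

lemma weight_lie_bracket:
  assumes a: "\<And>k. a k \<in> torus_smooth" and a': "\<And>k. a' k \<in> torus_smooth"
    and b: "b \<in> torus_smooth" and b': "b' \<in> torus_smooth"
  shows "weight lam (lie_bracket a a') (\<lambda>\<phi>. along a b' \<phi> - along a' b \<phi>) \<phi> =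
    along a (weight lam a' b') \<phi> - along a' (weight lam a b) \<phi>"
proof -
  have along_weight: "along a (weight lam a' b') \<phi> =
      of_real (along a b' \<phi> - (\<Sum>j\<in>UNIV. along a (a' j) \<phi> * lam $ j)) - (\<i> / 2) * of_real (along a (divergence a') \<phi>)"
    if "\<And>k. a k \<in> torus_smooth" "\<And>k. a' k \<in> torus_smooth" "b' \<in> torus_smooth"
    for a a' :: "'a \<Rightarrow> real^'a \<Rightarrow> real" and b'
  proof -
    have "along a (potential lam a' b') \<phi> = along a b' \<phi> - (\<Sum>j\<in>UNIV. along a (a' j) \<phi> * lam $ j)"
      using that unfolding potential_def[abs_def]
      by (simp add: along_diff along_sum along_mult along_const torus_smooth_intros)
    moreover have "along a (weight lam a' b') \<phi> =
        of_real (along a (potential lam a' b') \<phi>) - (\<i> / 2) * of_real (along a (divergence a') \<phi>)"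
      using that unfolding weight_def[abs_def]
      by (simp only: along_diff along_mult along_const along_of_real torus_smooth_of_real torus_smooth_mult
          torus_smooth_const potential_smooth divergence_smooth mult_zero_left add_0_right)
    ultimately show ?thesis by simp
  qed
  show ?thesis
    by (simp add: along_weight a a' b b')
      (simp add: weight_def potential_def divergence_lie_bracket a a', 
       simp add: lie_bracket_def algebra_simps sum_subtractf diff_divide_distrib)
qed

lemma dirac_condition_coeff_operator:
  assumes a: "\<And>k. a k \<in> torus_smooth" and a': "\<And>k. a' k \<in> torus_smooth"
    and b: "b \<in> torus_smooth" and b': "b' \<in> torus_smooth" and \<rho>: "\<rho> \<in> torus_smooth"
  shows "commutator (coeff_operator lam a b) (coeff_operator lam a' b') \<rho> \<phi> =
    - \<i> * coeff_operator lam (lie_bracket a a') (\<lambda>\<phi>. along a b' \<phi> - along a' b \<phi>) \<rho> \<phi>"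
proof -
  \<comment> \<open>The last two lines of the expansion are symmetric in the two operators, so the
    commutator keeps the first line.\<close>
  have product: "coeff_operator lam a b (coeff_operator lam a' b' \<rho>) \<phi> =
      - along a (along a' \<rho>) \<phi> - \<i> * along a (weight lam a' b') \<phi> * \<rho> \<phi>
      - \<i> * (weight lam a' b' \<phi> * along a \<rho> \<phi> + weight lam a b \<phi> * along a' \<rho> \<phi>)
      + weight lam a b \<phi> * weight lam a' b' \<phi> * \<rho> \<phi>"
    if "\<And>k. a k \<in> torus_smooth" "\<And>k. a' k \<in> torus_smooth" "b' \<in> torus_smooth"
    for a a' :: "'a \<Rightarrow> real^'a \<Rightarrow> real" and b b'
  proof -
    have "along a (coeff_operator lam a' b' \<rho>) \<phi> = - \<i> * along a (along a' \<rho>) \<phi>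
        + (weight lam a' b' \<phi> * along a \<rho> \<phi> + along a (weight lam a' b') \<phi> * \<rho> \<phi>)"
      using that \<rho> unfolding coeff_operator_eq[abs_def]
      by (simp only: along_add along_mult along_const torus_smooth_mult torus_smooth_const
          along_smooth weight_smooth mult_zero_left add_0_right)
    then show ?thesis
      unfolding coeff_operator_eq[of lam a b] by (simp only: coeff_operator_eq[of lam a' b' \<rho>]) (simp add: algebra_simps)
  qed
  show ?thesis
    using along_commutator[of a a' \<rho> \<phi>, OF a a' \<rho>]
    unfolding commutator_def product[of a a' b' b, OF a a' b'] product[of a' a b b', OF a' a b]
      coeff_operator_eq[of _ "lie_bracket a a'"] weight_lie_bracket[of a a' b b', OF a a' b b']
    by (simp add: algebra_simps)
qed


section \<open>The algebra of affine functions\<close>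

text \<open>Smoothness and periodicity on phase space are inherited from the coefficients, so
  brackets and action functions enter the algebra through their affine forms.\<close>

lemma affine_form_imp_affine_algebra:
  assumes V: "domain V" and f: "affine_form V f a b"
  shows "f \<in> affine_algebra V"
proof -
  have a: "\<And>k. a k \<in> torus_smooth" and b: "b \<in> torus_smooth"
    and eq: "\<And>I \<phi>. I \<in> V \<Longrightarrow> f (I, \<phi>) = (\<Sum>k\<in>UNIV. a k \<phi> * I $ k) + b \<phi>"
    using f by (auto simp: affine_form_def)
  have op: "open (V \<times> UNIV :: ((real^'a) \<times> (real^'a)) set)"
    using V by (simp add: domain_def open_Times)
  have snd: "smooth_on (V \<times> UNIV) (\<lambda>z. h (snd z))" if "h \<in> torus_smooth" for h :: "real^'a \<Rightarrow> real"
    using smooth_on_compose_bounded_linear[OF bounded_linear_snd op subset_UNIV torus_smoothD(1)[OF that]] .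
  have fst: "smooth_on (V \<times> UNIV) (\<lambda>z::(real^'a) \<times> (real^'a). fst z $ k)" for k
    by (intro smooth_on_bounded_linear_self op bounded_linear_compose[OF bounded_linear_vec_nth bounded_linear_fst])
  have "smooth_on (V \<times> UNIV) (\<lambda>z. (\<Sum>k\<in>UNIV. a k (snd z) * fst z $ k) + b (snd z))"
    by (intro smooth_on_add smooth_on_sum smooth_on_mult op fst snd a b)
  then have "smooth_on (V \<times> UNIV) f"
    using eq by (subst smooth_on_cong[OF op]) auto
  then have "f \<in> phase_smooth V"
    using torus_smoothD(2)[OF a] torus_smoothD(2)[OF b] by (simp add: phase_smooth_def eq)
  then show ?thesis
    using f by (auto simp: affine_algebra_def)
qed

text \<open>The affine formula agrees with \<open>f\<close> on the open set
  \<open>V \<times> UNIV\<close>, so both have the same derivative at each of its points.\<close>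

lemma affine_form_partials:
  assumes V: "domain V" and f: "affine_form V f a b" and I: "I \<in> V"
  shows "partial_I k f (I, \<phi>) = a k \<phi>"
    and "partial_phi k f (I, \<phi>) = (\<Sum>j\<in>UNIV. partial k (a j) \<phi> * I $ j) + partial k b \<phi>"
proof -
  have a: "\<And>k. a k \<in> torus_smooth" and b: "b \<in> torus_smooth"
    and eq: "\<And>I \<phi>. I \<in> V \<Longrightarrow> f (I, \<phi>) = (\<Sum>k\<in>UNIV. a k \<phi> * I $ k) + b \<phi>"
    using f by (auto simp: affine_form_def)
  let ?g = "\<lambda>z. (\<Sum>j\<in>UNIV. a j (snd z) * fst z $ j) + b (snd z)"
  let ?D = "\<lambda>h. (\<Sum>j\<in>UNIV. a j \<phi> * fst h $ j + frechet_derivative (a j) (at \<phi>) (snd h) * I $ j)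
      + frechet_derivative b (at \<phi>) (snd h)"
  have snd: "((\<lambda>z. h (snd z)) has_derivative (\<lambda>v. frechet_derivative h (at \<phi>) (snd v))) (at (I, \<phi>))"
    if "h \<in> torus_smooth" for h :: "real^'a \<Rightarrow> real"
    by (rule has_derivative_compose[of snd snd])
      (auto intro!: torus_smooth_has_derivative that has_derivative_snd has_derivative_ident)
  have fst: "((\<lambda>z. fst z $ j) has_derivative (\<lambda>v. fst v $ j)) (at (I, \<phi>))" for j
    by (intro bounded_linear_imp_has_derivative bounded_linear_compose[OF bounded_linear_vec_nth bounded_linear_fst])
  have summand: "((\<lambda>z. a j (snd z) * fst z $ j) has_derivative
      (\<lambda>h. a j \<phi> * fst h $ j + frechet_derivative (a j) (at \<phi>) (snd h) * I $ j)) (at (I, \<phi>))" for j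
    using has_derivative_mult[OF snd[OF a] fst] by simp
  have "(?g has_derivative ?D) (at (I, \<phi>))"
    by (rule has_derivative_add[OF has_derivative_sum snd[OF b]]) (rule summand)
  moreover have "open (V \<times> UNIV :: ((real^'a) \<times> (real^'a)) set)"
    using V by (simp add: domain_def open_Times)
  ultimately have "(f has_derivative ?D) (at (I, \<phi>))"
    by (rule has_derivative_transform_within_open[of _ _ _ _ "V \<times> UNIV"]) (use I eq in auto)
  then have D: "frechet_derivative f (at (I, \<phi>)) = ?D"
    by (rule frechet_derivative_at[symmetric])
  \<comment> \<open>In an action direction the torus component is the zero vector, where the
    derivatives of the coefficients give zero.\<close>
  have "frechet_derivative h (at \<phi>) 0 = 0" if "h \<in> torus_smooth" for h :: "real^'a \<Rightarrow> real"
    using linear_0[OF linear_frechet_derivative[OF torus_smoothD(3)[OF that]]] .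
  then show "partial_I k f (I, \<phi>) = a k \<phi>"
    by (simp add: partial_I_def D a b axis_def if_distrib[of "\<lambda>x. _ * x"] sum.delta cong: if_cong)
  show "partial_phi k f (I, \<phi>) = (\<Sum>j\<in>UNIV. partial k (a j) \<phi> * I $ j) + partial k b \<phi>"
    by (simp add: partial_phi_def D partial_def)
qed

text \<open>Derivatives in the action variables are free of \<open>I\<close>, so each product in the
  bracket is affine in \<open>I\<close>; collecting the linear terms gives the Lie bracket of the
  fields.\<close>

lemma affine_form_poisson_bracket:
  assumes V: "domain V" and f: "affine_form V f a b" and f': "affine_form V f' a' b'"
  shows "affine_form V (poisson_bracket f f') (lie_bracket a a') (\<lambda>\<phi>. along a b' \<phi> - along a' b \<phi>)"
proof -
  have ab: "\<And>k. a k \<in> torus_smooth" "b \<in> torus_smooth" "\<And>k. a' k \<in> torus_smooth" "b' \<in> torus_smooth"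
    using f f' by (auto simp: affine_form_def)
  have swap: "(\<Sum>k\<in>UNIV. a k \<phi> * (\<Sum>j\<in>UNIV. partial k (a' j) \<phi> * I $ j)) = (\<Sum>j\<in>UNIV. along a (a' j) \<phi> * I $ j)"
    for a a' :: "'a \<Rightarrow> real^'a \<Rightarrow> real" and \<phi> I
    unfolding along_def sum_distrib_left sum_distrib_right by (subst sum.swap) (simp add: mult.assoc)
  have "poisson_bracket f f' (I, \<phi>) =
      (\<Sum>j\<in>UNIV. lie_bracket a a' j \<phi> * I $ j) + (along a b' \<phi> - along a' b \<phi>)" if "I \<in> V" for I \<phi>
  proof -
    have "poisson_bracket f f' (I, \<phi>) =
        (\<Sum>k\<in>UNIV. a k \<phi> * (\<Sum>j\<in>UNIV. partial k (a' j) \<phi> * I $ j)) + along a b' \<phi>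
        - (\<Sum>k\<in>UNIV. a' k \<phi> * (\<Sum>j\<in>UNIV. partial k (a j) \<phi> * I $ j)) - along a' b \<phi>"
      unfolding poisson_bracket_def affine_form_partials[OF V f that] affine_form_partials[OF V f' that]
      by (simp add: along_def[of _ b] along_def[of _ b'] distrib_left distrib_right sum_subtractf sum.distrib mult.commute)
    then show ?thesis
      by (simp add: swap lie_bracket_def left_diff_distrib sum_subtractf)
  qed
  then show ?thesis
    using ab by (auto simp: affine_form_def intro!: lie_bracket_smooth torus_smooth_diff along_smooth)
qed

section \<open>Action operators and inequivalence of representations\<close>

lemma affine_form_action_fun:
  "affine_form V (action_fun k) (\<lambda>j \<phi>. if j = k then 1 else 0) (\<lambda>\<phi>. 0)"
  by (auto simp: affine_form_def action_fun_def torus_smooth_const mult_delta_left sum.delta)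

text \<open>An action function has constant coefficients, so the divergence term drops out.\<close>

lemma quantization_action_fun:
  assumes "domain V"
  shows "quantization V lam (action_fun k) \<rho> = (\<lambda>\<phi>. - \<i> * partial k \<rho> \<phi> - of_real (lam $ k) * \<rho> \<phi>)"
  by (simp add: quantization_eq[OF assms affine_form_action_fun] coeff_operator_def partial_const fun_eq_iff
      if_distrib[of of_real] mult_delta_left sum.delta cong: if_cong)

lemma quantization_action_fun_fourier_mode:
  assumes "domain V"
  shows "quantization V lam (action_fun k) (fourier_mode n) =
    (\<lambda>\<phi>. of_real (of_int (n $ k) - lam $ k) * fourier_mode n \<phi>)"
  by (simp add: quantization_action_fun[OF assms] partial_fourier_mode algebra_simps)

text \<open>Along the \<open>k\<close>-th circle an eigenfunction is a multiple of \<open>exp (\<i> * c * t)\<close>, which has to be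
  \<open>2 pi\<close>-periodic.\<close>

lemma partial_eigenvalue_integer:
  fixes g :: "real^'m \<Rightarrow> complex"
  assumes g: "g \<in> torus_smooth" and eigen: "\<And>\<phi>. partial k g \<phi> = \<i> * of_real c * g \<phi>" and nz: "g \<phi> \<noteq> 0"
  shows "c \<in> \<int>"
proof -
  \<comment> \<open>Multiplying by the inverse exponential turns the eigenvalue equation into a
    vanishing derivative.\<close>
  define h where "h t = exp (- (\<i> * of_real c * of_real t)) * g (\<phi> + axis k t)" for t
  have "(h has_vector_derivative 0) (at t within UNIV)" for t
  proof -
    have "((\<lambda>t. exp (- (\<i> * of_real c * of_real t))) has_vector_derivative
        - (\<i> * of_real c) * exp (- (\<i> * of_real c * of_real t))) (at t)"
      by (rule has_vector_derivative_real_field) (auto intro!: derivative_eq_intros)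
    from has_vector_derivative_mult[OF this has_vector_derivative_partial[OF g, of \<phi> k t UNIV]]
    show ?thesis
      by (simp add: h_def[abs_def] eigen algebra_simps)
  qed
  then obtain d where "\<And>t. h t = d"
    using has_vector_derivative_zero_constant[of UNIV h] by auto
  then have "h (2 * pi) = h 0" by simp
  moreover have "g (\<phi> + axis k 0) = g \<phi>"
    by (metis add.right_neutral axis_eq_0_iff)
  ultimately have "exp (- (\<i> * of_real c * of_real (2 * pi))) = 1"
    using nz torus_smoothD(2)[OF g, of \<phi> k] by (simp add: h_def)
  \<comment> \<open>\<open>exp_eq_1\<close> makes the exponent a multiple of 2 pi \<i>; cancelling 2
    pi leaves an integer up to sign.\<close>
  then obtain i :: int where "- (c * (2 * pi)) = of_int (2 * i) * pi"
    by (auto simp: exp_eq_1)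
  then have "pi * c = pi * of_int (- i)"
    by (simp add: algebra_simps)
  then have "c = of_int (- i)"
    by (metis mult_left_cancel pi_neq_zero)
  then show ?thesis by (metis Ints_of_int)
qed

lemma equivalent_reps_imp_integer_diff:
  fixes V :: "(real^'m) set"
  assumes V: "domain V"
    and "equivalent_reps (affine_algebra V) (quantization V lam) (quantization V lam')"
  shows "lam $ k - lam' $ k \<in> \<int>"
proof -
  obtain U where U: "unitary_operator U"
    and inter: "\<And>f \<rho>. f \<in> affine_algebra V \<Longrightarrow> \<rho> \<in> torus_smooth \<Longrightarrow>
      U (quantization V lam f \<rho>) = quantization V lam' f (U \<rho>)"
    using assms(2) by (auto simp: equivalent_reps_def)
  have TU: "torus_operator U"
    and iso: "\<And>\<rho> \<rho>'. \<rho> \<in> torus_smooth \<Longrightarrow> \<rho>' \<in> torus_smooth \<Longrightarrow> torus_inner (U \<rho>) (U \<rho>') = torus_inner \<rho> \<rho>'"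
    using U by (auto simp: unitary_operator_def)
  \<comment> \<open>The constant mode is an eigenvector of every action operator, with eigenvalue
    \<open>- lam $ k\<close>; its image has the same eigenvalue for the operators of
    \<open>lam'\<close>.\<close>
  define g where "g = U (fourier_mode 0)"
  have g: "g \<in> torus_smooth"
    using TU fourier_mode_smooth by (auto simp: g_def torus_operator_def)
  have scale: "U (\<lambda>\<phi>. c * fourier_mode 0 \<phi>) = (\<lambda>\<phi>. c * g \<phi>)" for c
    using TU fourier_mode_smooth[of 0] unfolding torus_operator_def g_def by blast
  have "(\<lambda>\<phi>. of_real (- lam $ k) * g \<phi>) = U (quantization V lam (action_fun k) (fourier_mode 0))"
    unfolding quantization_action_fun_fourier_mode[OF V] scale by simp
  also have "\<dots> = quantization V lam' (action_fun k) g"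
    unfolding g_def
    by (intro inter affine_form_imp_affine_algebra[OF V affine_form_action_fun] fourier_mode_smooth)
  also have "\<dots> = (\<lambda>\<phi>. - \<i> * partial k g \<phi> - of_real (lam' $ k) * g \<phi>)"
    by (rule quantization_action_fun[OF V])
  finally have eq: "of_real (- lam $ k) * g \<phi> = - \<i> * partial k g \<phi> - of_real (lam' $ k) * g \<phi>" for \<phi>
    by (rule fun_cong)
  have eigen: "partial k g \<phi> = \<i> * of_real (lam' $ k - lam $ k) * g \<phi>" for \<phi>
    using arg_cong[OF eq[of \<phi>], of "\<lambda>x. \<i> * x"] by (simp add: algebra_simps)
  \<comment> \<open>Isometry preserves the norm of the constant mode, which yields a point where
    \<open>g\<close> does not vanish.\<close>
  have "torus_inner g g = 1"
    by (simp add: g_def iso fourier_mode_smooth torus_inner_fourier_mode)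
  then obtain \<phi> where "g \<phi> \<noteq> 0"
    by (force simp: torus_inner_def)
  from partial_eigenvalue_integer[OF g eigen this] show ?thesis
    by (metis Ints_minus minus_diff_eq)
qed

theorem mainTheorem2:
  fixes V :: "(real^'m) set"
  assumes "domain V"
  shows
    "(\<forall>lam. (\<forall>f\<in>affine_algebra V. hermitian_operator (quantization V lam f)) \<and>
        (\<forall>f\<in>affine_algebra V. \<forall>f'\<in>affine_algebra V.
           poisson_bracket f f' \<in> affine_algebra V \<and>
           (\<forall>\<rho>\<in>torus_smooth.
              commutator (quantization V lam f) (quantization V lam f') \<rho>
              = (\<lambda>\<phi>. - \<i> * quantization V lam (poisson_bracket f f') \<rho> \<phi>))))
   \<and> (orthonormal_basis (fourier_mode :: int^'m \<Rightarrow> real^'m \<Rightarrow> complex) \<and>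
      (\<forall>k. action_fun k \<in> affine_algebra V) \<and>
      (\<forall>lam k.
        (\<forall>\<rho>\<in>torus_smooth. quantization V lam (action_fun k) \<rho>
           = (\<lambda>\<phi>. - \<i> * partial k \<rho> \<phi> - of_real (lam $ k) * \<rho> \<phi>)) \<and>
        (\<forall>n. quantization V lam (action_fun k) (fourier_mode n)
           = (\<lambda>\<phi>. of_real (of_int (n $ k) - lam $ k) * fourier_mode n \<phi>))))
   \<and> (\<forall>lam lam'.
        equivalent_reps (affine_algebra V) (quantization V lam) (quantization V lam') \<longrightarrow>
        (\<forall>k. lam $ k - lam' $ k \<in> \<int>))"
proof (intro conjI allI ballI impI)
  fix lam f assume "f \<in> affine_algebra V"
  then obtain a b where f: "affine_form V f a b"
    by (auto simp: affine_algebra_def)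
  then show "hermitian_operator (quantization V lam f)"
    unfolding quantization_eq[OF assms f] by (intro hermitian_coeff_operator) (auto simp: affine_form_def)
next
  fix lam f f' assume "f \<in> affine_algebra V" "f' \<in> affine_algebra V"
  then obtain a b a' b' where f: "affine_form V f a b" and f': "affine_form V f' a' b'"
    by (auto simp: affine_algebra_def)
  \<comment> \<open>The explicit coefficients of the bracket serve twice: for membership in the
    algebra and, by their uniqueness, to evaluate its quantization.\<close>
  note bracket = affine_form_poisson_bracket[OF assms f f']
  show "poisson_bracket f f' \<in> affine_algebra V"
    by (rule affine_form_imp_affine_algebra[OF assms bracket])
  show "commutator (quantization V lam f) (quantization V lam f') \<rho>
      = (\<lambda>\<phi>. - \<i> * quantization V lam (poisson_bracket f f') \<rho> \<phi>)" if "\<rho> \<in> torus_smooth" for \<rho>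
    unfolding quantization_eq[OF assms f] quantization_eq[OF assms f'] quantization_eq[OF assms bracket]
    using f f' that by (intro ext dirac_condition_coeff_operator) (auto simp: affine_form_def)
next
  show "orthonormal_basis (fourier_mode :: int^'m \<Rightarrow> real^'m \<Rightarrow> complex)"
    by (rule orthonormal_basis_fourier_mode)
next
  fix k
  show "action_fun k \<in> affine_algebra V"
    by (rule affine_form_imp_affine_algebra[OF assms affine_form_action_fun])
qed (rule assms quantization_action_fun quantization_action_fun_fourier_mode equivalent_reps_imp_integer_diff | assumption)+

end
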